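(* There is an absolute constant $C>0$ such that the following holds. Let $p$ be a prime, let $A=\sum_{i=1}^m A_ix_i$ where each $A_i$ is an $n\times n$ integer matrix all of whose entries have absolute value at most $D$ ($D\ge1$). If $A$ is nc-regular, then $v_p\mathrm{Det}'A\le C\,n\log_p(nD)$. Consequently, if the algorithm Val-Det applied to $A$ performs more than $C\,n\log_p(nD)$ iterations (executions of the update in step 2), then $A$ is nc-singular.
   Context: Nc-rank: for a field $\mathbb{F}$ and $n\times n$ matrices $B_i$ over $\mathbb{F}$, the nc-rank of $B=\sum_{i=1}^mB_ix_i$ is the rank of $B$ regarded as a matrix over the free skew field $\mathbb{F}(\langle x_1,\dots,x_m\rangle)$. By a theorem of Fortin and Reutenauer it equals the optimal value of problem FR: minimize $2n-r-s$ over $S,T\in GL_n(\mathbb{F})$ and $r,s$ such that $SBT$ has an $r\times s$ zero submatrix (i.e. all $SB_iT$ vanish on a common $r\times s$ block). $B$ is nc-regular if its nc-rank is $n$ and nc-singular if its nc-rank is $<n$. Valuation: $v_p:\mathbb{Q}\to\mathbb{Z}\cup\{\infty\}$ is the $p$-adic valuation, extended to $\mathbb{Q}[x_1,\dots,x_m]$ by $v_p(f):=\min$ of the valuations of the coefficients of $f$, and to rational functions by $v_p(f/g)=v_p(f)-v_p(g)$ (Gauss extension). Problem MVMP for $A$: maximize $-v_p\det P-v_p\det Q$ over $P,Q\in GL_n(\mathbb{Q})$ subject to $v_p((PAQ)_{ij})\ge0$ for all $i,j\in\{1,\dots,n\}$. Its optimal value is denoted $v_p\mathrm{Det}'A\in\mathbb{Z}\cup\{\infty\}$,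 with value $\infty$ if MVMP is unbounded. For feasible $(P,Q)$, each $PA_iQ$ has $p$-integral entries, and $(PA_iQ)^{(0)}$ denotes its reduction modulo $p$ (leading term of the $p$-adic expansion), a matrix over $GF(p)$; $(PAQ)^{(0)}:=\sum_{i=1}^m(PA_iQ)^{(0)}x_i$ over $GF(p)$. Algorithm Val-Det: (0) Let $(P,Q):=(I,I)$. (1) Solve FR for $(PAQ)^{(0)}$ over $GF(p)$, obtaining optimal $S,T\in GL_n(GF(p))$ such that $S(PAQ)^{(0)}T$ has an $r\times s$ zero submatrix in its upper-left corner, with $2n-r-s$ minimum. (2) If $(PAQ)^{(0)}$ is nc-singular, i.e. $n<r+s$, then regard $S,T$ as rational matrices with entries in $\{0,1,\dots,p-1\}$, update $(P,Q)\leftarrow(\mathrm{diag}(p^{-1},\dots,p^{-1},1,\dots,1)SP,\ QT\,\mathrm{diag}(1,\dots,1,p,\dots,p))$, where the first diagonal matrix has $p^{-1}$ in the first $r$ positions and $1$ elsewhere and the second has $1$ in the first $s$ positions and $p$ elsewhere, and go to step 1. Otherwise stop. *)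

theory Defs
  imports
    Jordan_Normal_Form.Determinant
    Jordan_Normal_Form.Gauss_Jordan_Elimination
    "HOL-Computational_Algebra.Primes"
    "HOL-Library.Extended_Real"
    "HOL-Library.Monad_Syntax"
    Complex_Main
begin

text \<open>A linear pencil \<open>B = B\<^sub>0 x\<^sub>0 + \<dots> + B\<^sub>m\<^sub>-\<^sub>1 x\<^sub>m\<^sub>-\<^sub>1\<close> is given by \<open>m\<close> and its coefficient
  matrices \<open>B :: nat \<Rightarrow> 'a mat\<close>; only \<open>B k\<close> with \<open>k < m\<close> matters.\<close>

section \<open>The free skew field and the nc-rank\<close>

text \<open>Amitsur's construction. The elements of the free skew field \<open>F(\<langle>x\<^sub>0, \<dots>, x\<^sub>m\<^sub>-\<^sub>1\<rangle>)\<close> are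
  represented by rational expressions in noncommuting variables that can be evaluated on at least
  one tuple of square matrices over \<open>F\<close> (of some positive size). Two such expressions represent the
  same element iff their values agree on all matrix tuples, of every size, on which both are
  defined.\<close>

datatype 'a nc_exp =
    NC_Const 'a
  | NC_Var nat
  | NC_Add "'a nc_exp" "'a nc_exp"
  | NC_Mult "'a nc_exp" "'a nc_exp"
  | NC_Inv "'a nc_exp"

primrec nc_vars :: "'a nc_exp \<Rightarrow> nat set" where
  "nc_vars (NC_Const c) = {}"
| "nc_vars (NC_Var k) = {k}"
| "nc_vars (NC_Add e f) = nc_vars e \<union> nc_vars f"
| "nc_vars (NC_Mult e f) = nc_vars e \<union> nc_vars f"
| "nc_vars (NC_Inv e) = nc_vars e"

text \<open>Evaluation at \<open>d \<times> d\<close> matrices; the value is \<open>None\<close> as soon as a singular matrix would have to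
  be inverted.\<close>

primrec nc_eval :: "nat \<Rightarrow> (nat \<Rightarrow> 'a :: field mat) \<Rightarrow> 'a nc_exp \<Rightarrow> 'a mat option" where
  "nc_eval d X (NC_Const c) = Some (c \<cdot>\<^sub>m 1\<^sub>m d)"
| "nc_eval d X (NC_Var k) = Some (X k)"
| "nc_eval d X (NC_Add e f) = do { M \<leftarrow> nc_eval d X e; N \<leftarrow> nc_eval d X f; Some (M + N) }"
| "nc_eval d X (NC_Mult e f) = do { M \<leftarrow> nc_eval d X e; N \<leftarrow> nc_eval d X f; Some (M * N) }"
| "nc_eval d X (NC_Inv e) = do { M \<leftarrow> nc_eval d X e; mat_inverse M }"

definition nc_points :: "nat \<Rightarrow> nat \<Rightarrow> (nat \<Rightarrow> 'a :: field mat) set" where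
  "nc_points m d = {X. \<forall>k<m. X k \<in> carrier_mat d d}"

definition nc_rational :: "nat \<Rightarrow> 'a :: field nc_exp set" where
  "nc_rational m = {e. nc_vars e \<subseteq> {..<m} \<and>
     (\<exists>d>0. \<exists>X \<in> nc_points m d. nc_eval d X e \<noteq> None)}"

definition nc_equal :: "nat \<Rightarrow> 'a :: field nc_exp \<Rightarrow> 'a nc_exp \<Rightarrow> bool" where
  "nc_equal m e f \<longleftrightarrow> e \<in> nc_rational m \<and> f \<in> nc_rational m \<and>
     (\<forall>d>0. \<forall>X \<in> nc_points m d.
        nc_eval d X e \<noteq> None \<longrightarrow> nc_eval d X f \<noteq> None \<longrightarrow> nc_eval d X e = nc_eval d X f)"

primrec nc_sum :: "(nat \<Rightarrow> 'a :: zero nc_exp) \<Rightarrow> nat \<Rightarrow> 'a nc_exp" where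
  "nc_sum e 0 = NC_Const 0"
| "nc_sum e (Suc n) = NC_Add (nc_sum e n) (e n)"

definition pencil_entry :: "nat \<Rightarrow> (nat \<Rightarrow> 'a :: field mat) \<Rightarrow> nat \<Rightarrow> nat \<Rightarrow> 'a nc_exp" where
  "pencil_entry m B i j = nc_sum (\<lambda>k. NC_Mult (NC_Const (B k $$ (i, j))) (NC_Var k)) m"

text \<open>Rank over a skew field \<open>K\<close>: the dimension of the right column space, i.e. the least \<open>r\<close> such
  that some \<open>r\<close> vectors of \<open>K\<^sup>n\<close> (the columns of \<open>V\<close>) have all columns of the matrix in their
  right \<open>K\<close>-linear span (with coefficients \<open>W\<close>).\<close>

definition nc_rank :: "nat \<Rightarrow> nat \<Rightarrow> (nat \<Rightarrow> 'a :: field mat) \<Rightarrow> nat" where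
  "nc_rank n m B = (LEAST r. \<exists>V W.
     (\<forall>i<n. \<forall>k<r. V i k \<in> nc_rational m) \<and>
     (\<forall>k<r. \<forall>j<n. W k j \<in> nc_rational m) \<and>
     (\<forall>i<n. \<forall>j<n. nc_equal m (pencil_entry m B i j) (nc_sum (\<lambda>k. NC_Mult (V i k) (W k j)) r)))"

definition nc_regular :: "nat \<Rightarrow> nat \<Rightarrow> (nat \<Rightarrow> 'a :: field mat) \<Rightarrow> bool" where
  "nc_regular n m B \<longleftrightarrow> nc_rank n m B = n"

definition nc_singular :: "nat \<Rightarrow> nat \<Rightarrow> (nat \<Rightarrow> 'a :: field mat) \<Rightarrow> bool" where
  "nc_singular n m B \<longleftrightarrow> nc_rank n m B < n"

section \<open>The p-adic valuation and the problem MVMP\<close>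

text \<open>The value group \<open>\<int> \<union> {\<infinity>}\<close> is embedded in the complete lattice \<open>ereal\<close>.\<close>

definition vp :: "nat \<Rightarrow> rat \<Rightarrow> ereal" where
  "vp p x = (if x = 0 then \<infinity> else
     (case quotient_of x of (a, b) \<Rightarrow>
        ereal (real (multiplicity (int p) a) - real (multiplicity (int p) b))))"

text \<open>Gauss extension of \<open>vp\<close>, for the linear form in position \<open>(i, j)\<close> of a pencil: the minimum
  valuation of its coefficients, which is \<open>\<infinity>\<close> for the zero form.\<close>

definition vp_entry :: "nat \<Rightarrow> nat \<Rightarrow> (nat \<Rightarrow> rat mat) \<Rightarrow> nat \<Rightarrow> nat \<Rightarrow> ereal" where
  "vp_entry p m B i j = (INF k\<in>{..<m}. vp p (B k $$ (i, j)))"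

definition GL :: "nat \<Rightarrow> 'a :: field mat set" where
  "GL n = {P \<in> carrier_mat n n. invertible_mat P}"

definition transform :: "rat mat \<Rightarrow> (nat \<Rightarrow> rat mat) \<Rightarrow> rat mat \<Rightarrow> nat \<Rightarrow> rat mat" where
  "transform P A Q = (\<lambda>k. P * A k * Q)"

definition mvmp_feasible :: "nat \<Rightarrow> nat \<Rightarrow> nat \<Rightarrow> (nat \<Rightarrow> rat mat) \<Rightarrow> (rat mat \<times> rat mat) set" where
  "mvmp_feasible p n m A = {(P, Q). P \<in> GL n \<and> Q \<in> GL n \<and>
     (\<forall>i<n. \<forall>j<n. vp_entry p m (transform P A Q) i j \<ge> 0)}"

definition vp_Det' :: "nat \<Rightarrow> nat \<Rightarrow> nat \<Rightarrow> (nat \<Rightarrow> rat mat) \<Rightarrow> ereal" where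
  "vp_Det' p n m A = (SUP (P, Q) \<in> mvmp_feasible p n m A. - vp p (det P) - vp p (det Q))"

section \<open>The problem FR over GF(p)\<close>

text \<open>\<open>GF(p)\<close> is represented by the residues \<open>{0..<p}\<close> with arithmetic modulo \<open>p\<close>.\<close>

definition mat_mod :: "nat \<Rightarrow> int mat \<Rightarrow> int mat" where
  "mat_mod p M = map_mat (\<lambda>x. x mod int p) M"

definition mat_GF :: "nat \<Rightarrow> nat \<Rightarrow> int mat set" where
  "mat_GF p n = {M \<in> carrier_mat n n. \<forall>i<n. \<forall>j<n. M $$ (i, j) \<in> {0..<int p}}"

definition GL_GF :: "nat \<Rightarrow> nat \<Rightarrow> int mat set" where
  "GL_GF p n = {S \<in> mat_GF p n. \<exists>S' \<in> mat_GF p n.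
     mat_mod p (S * S') = 1\<^sub>m n \<and> mat_mod p (S' * S) = 1\<^sub>m n}"

text \<open>The leading term \<open>x\<^sup>(\<^sup>0\<^sup>)\<close> of the \<open>p\<close>-adic expansion of a \<open>p\<close>-integral rational number.\<close>

definition residue :: "nat \<Rightarrow> rat \<Rightarrow> int" where
  "residue p x = (THE c. c \<in> {0..<int p} \<and> vp p (x - of_int c) > 0)"

definition reduce :: "nat \<Rightarrow> (nat \<Rightarrow> rat mat) \<Rightarrow> nat \<Rightarrow> int mat" where
  "reduce p B = (\<lambda>k. map_mat (residue p) (B k))"

definition zero_block ::
  "nat \<Rightarrow> nat \<Rightarrow> (nat \<Rightarrow> int mat) \<Rightarrow> int mat \<Rightarrow> int mat \<Rightarrow> nat set \<Rightarrow> nat set \<Rightarrow> bool" where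
  "zero_block p m B S T I J \<longleftrightarrow>
     (\<forall>k<m. \<forall>i\<in>I. \<forall>j\<in>J. mat_mod p (S * B k * T) $$ (i, j) = 0)"

definition fr_feasible ::
  "nat \<Rightarrow> nat \<Rightarrow> nat \<Rightarrow> (nat \<Rightarrow> int mat) \<Rightarrow> int mat \<Rightarrow> int mat \<Rightarrow> nat \<Rightarrow> nat \<Rightarrow> bool" where
  "fr_feasible p n m B S T r s \<longleftrightarrow> S \<in> GL_GF p n \<and> T \<in> GL_GF p n \<and>
     (\<exists>I J. I \<subseteq> {..<n} \<and> J \<subseteq> {..<n} \<and> card I = r \<and> card J = s \<and> zero_block p m B S T I J)"

text \<open>Optimal solutions of FR whose zero submatrix is in the upper-left corner. The natural-number
  subtractions do not truncate, since feasibility forces \<open>r \<le> n\<close> and \<open>s \<le> n\<close>.\<close>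

definition fr_optimal ::
  "nat \<Rightarrow> nat \<Rightarrow> nat \<Rightarrow> (nat \<Rightarrow> int mat) \<Rightarrow> int mat \<Rightarrow> int mat \<Rightarrow> nat \<Rightarrow> nat \<Rightarrow> bool" where
  "fr_optimal p n m B S T r s \<longleftrightarrow> S \<in> GL_GF p n \<and> T \<in> GL_GF p n \<and> r \<le> n \<and> s \<le> n \<and>
     zero_block p m B S T {..<r} {..<s} \<and>
     (\<forall>S' T' r' s'. fr_feasible p n m B S' T' r' s' \<longrightarrow> 2 * n - r - s \<le> 2 * n - r' - s')"

section \<open>The algorithm Val-Det\<close>

text \<open>One iteration, as a relation because the optimal solution of FR is not unique. There is no
  successor when the algorithm stops.\<close>

inductive val_det_step ::
  "nat \<Rightarrow> nat \<Rightarrow> nat \<Rightarrow> (nat \<Rightarrow> rat mat) \<Rightarrow> rat mat \<times> rat mat \<Rightarrow> rat mat \<times> rat mat \<Rightarrow> bool"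
  for p n m A where
  "fr_optimal p n m (reduce p (transform P A Q)) S T r s \<Longrightarrow> n < r + s \<Longrightarrow>
   val_det_step p n m A (P, Q)
     (mat_diag n (\<lambda>i. if i < r then 1 / of_nat p else 1) * map_mat of_int S * P,
      Q * map_mat of_int T * mat_diag n (\<lambda>j. if j < s then 1 else of_nat p))"

text \<open>Some run of the algorithm executes the update at least \<open>N\<close> times.\<close>

definition val_det_performs :: "nat \<Rightarrow> nat \<Rightarrow> nat \<Rightarrow> (nat \<Rightarrow> rat mat) \<Rightarrow> nat \<Rightarrow> bool" where
  "val_det_performs p n m A N \<longleftrightarrow> (\<exists>PQ. (val_det_step p n m A ^^ N) (1\<^sub>m n, 1\<^sub>m n) PQ)"

end

theory Submission
  imports Defs "HOL-Analysis.L2_Norm"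
begin

text \<open>Let \<open>(P, Q)\<close> be feasible. The columns of \<open>Q\<close> and the rows of \<open>P\<close> generate lattices over the
  localisation of \<open>\<int>\<close> at \<open>p\<close>; scaled by \<open>p\<^sup>a\<close> and \<open>p\<^sup>b\<close> and intersected with \<open>\<int>\<^sup>n\<close> they become lattices
  of index at most \<open>p\<close> to the power \<open>v\<^sub>p(det Q) + an\<close> and \<open>v\<^sub>p(det P) + bn\<close>. For vectors \<open>y\<close>, \<open>x\<close> in them the
  integer \<open>y\<^sup>T A\<^sub>k x\<close> is divisible by \<open>p\<^sup>a\<^sup>+\<^sup>b\<close>, while its absolute value is at most \<open>n D |x| |y|\<close>. By
  Minkowski's second theorem the lattices have linearly independent vectors, sorted by length, with
  \<open>\<Prod>|x\<^sub>i|\<close> and \<open>\<Prod>|y\<^sub>i|\<close> at most \<open>n\<^sup>n\<close> times the index. If \<open>- v\<^sub>p(det P) - v\<^sub>p(det Q)\<close> exceeds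
  \<open>3 n log\<^sub>p(n D)\<close>, then \<open>n D |x\<^sub>i| |y\<^sub>n\<^sub>+\<^sub>1\<^sub>-\<^sub>i| < p\<^sup>a\<^sup>+\<^sup>b\<close> for some \<open>i\<close>, so that all \<open>y\<^sub>j\<^sup>T A\<^sub>k x\<^sub>l\<close> with
  \<open>l \<le> i\<close> and \<open>j \<le> n + 1 - i\<close> vanish: over \<open>\<rat>\<close> the pencil has an \<open>(n + 1 - i) \<times> i\<close> zero block and hence
  nc-rank less than \<open>n\<close>. Only this easy direction of the Fortin--Reutenauer theorem is needed, and
  neither invertible blow-ups nor degree bounds. Finally, every update of Val-Det keeps \<open>(P, Q)\<close>
  feasible and increases the objective by \<open>r + s - n \<ge> 1\<close>.\<close>

section \<open>The \<open>p\<close>-adic valuation on the rationals\<close>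

lemma vp_0 [simp]: "vp p 0 = \<infinity>"
  by (simp add: vp_def)

text \<open>The localisation of the integers at \<open>p\<close>, as a subring of the
  rationals.\<close>

definition Zloc :: "nat \<Rightarrow> rat set" where
  "Zloc p = {x. vp p x \<ge> 0}"

context
  fixes p :: nat
  assumes prime: "prime p"
begin

lemma prime_int: "prime (int p)"
  using prime by simp

lemma mult_int_mult:
  assumes "a \<noteq> 0" "b \<noteq> 0"
  shows "multiplicity (int p) (a * b) = multiplicity (int p) a + multiplicity (int p) b"
  using assms prime_int by (simp add: prime_elem_multiplicity_mult_distrib)

text \<open>Frees the valuation from the reduced fraction in its definition. Cross-multiplying two
  representations of the same number gives an equation of integers, and multiplicity is additive on
  products.\<close>

lemma vp_frac:
  assumes "a \<noteq> 0" "b \<noteq> 0"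
  shows "vp p (of_int a / of_int b)
    = ereal (real (multiplicity (int p) a) - real (multiplicity (int p) b))"
proof -
  let ?x = "of_int a / of_int b :: rat"
  obtain a' b' where q: "quotient_of ?x = (a', b')"
    by (cases "quotient_of ?x")
  have x: "?x = of_int a' / of_int b'" and b': "b' > 0"
    using q quotient_of_div quotient_of_denom_pos by blast+
  have "?x \<noteq> 0"
    using assms by simp
  with x b' have a': "a' \<noteq> 0" by auto
  have "of_int (a * b') = (of_int (a' * b) :: rat)"
    using x assms b' by (simp add: field_simps)
  then have "a * b' = a' * b"
    using of_int_eq_iff by blast
  then have "multiplicity (int p) a + multiplicity (int p) b'
      = multiplicity (int p) a' + multiplicity (int p) b"
    using mult_int_mult[of a b'] mult_int_mult[of a' b] assms a' b' by auto
  then have "real (multiplicity (int p) a) + real (multiplicity (int p) b')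
      = real (multiplicity (int p) a') + real (multiplicity (int p) b)"
    unfolding of_nat_add[symmetric] by (rule arg_cong)
  then show ?thesis
    using q \<open>?x \<noteq> 0\<close> unfolding vp_def by simp
qed

lemma vp_of_int:
  assumes "a \<noteq> 0"
  shows "vp p (of_int a) = ereal (real (multiplicity (int p) a))"
  using vp_frac[of a 1] assms by simp

lemma rat_frac:
  fixes x :: rat
  obtains a b where "x = of_int a / of_int b" "b \<noteq> 0"
proof -
  obtain a b where "quotient_of x = (a, b)" by (cases "quotient_of x")
  then have "x = of_int a / of_int b" "b \<noteq> 0"
    using quotient_of_div quotient_of_denom_pos by force+
  then show ?thesis by (rule that)
qed

lemma vp_finite:
  assumes "x \<noteq> 0"
  obtains k :: int where "vp p x = ereal (real_of_int k)"
proof -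
  obtain a b where x: "x = of_int a / of_int b" "b \<noteq> 0"
    by (rule rat_frac)
  then have "vp p x = ereal (real_of_int
      (int (multiplicity (int p) a) - int (multiplicity (int p) b)))"
    using vp_frac[of a b] assms by simp
  then show ?thesis by (rule that)
qed

lemma vp_not_MInfty: "vp p x \<noteq> - \<infinity>"
  by (metis MInfty_neq_ereal(1) MInfty_neq_PInfty(1) vp_0 vp_finite)

lemma vp_mult: "vp p (x * y) = vp p x + vp p y"
proof (cases "x = 0 \<or> y = 0")
  case True
  then show ?thesis using vp_not_MInfty by auto
next
  case False
  obtain a b where x: "x = of_int a / of_int b" "b \<noteq> 0" by (rule rat_frac)
  obtain c d where y: "y = of_int c / of_int d" "d \<noteq> 0" by (rule rat_frac)
  have nz: "a \<noteq> 0" "c \<noteq> 0" using False x y by auto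
  have "x * y = of_int (a * c) / of_int (b * d)" using x y by simp
  then show ?thesis
    using vp_frac[of a b] vp_frac[of c d] vp_frac[of "a * c" "b * d"] nz x y
    by (simp add: mult_int_mult)
qed

text \<open>The ultrametric inequality, phrased with a common lower bound \<open>c\<close> so that
  it passes through finite sums by induction.\<close>

lemma vp_add:
  assumes "c \<le> vp p x" "c \<le> vp p y"
  shows "c \<le> vp p (x + y)"
proof (cases "x = 0 \<or> y = 0 \<or> x + y = 0")
  case True
  then show ?thesis using assms by auto
next
  case False
  obtain a b where x: "x = of_int a / of_int b" "b \<noteq> 0" by (rule rat_frac)
  obtain a' b' where y: "y = of_int a' / of_int b'" "b' \<noteq> 0" by (rule rat_frac)
  define u v d where "u = a * b'" and "v = a' * b" and "d = b * b'"
  have xy: "x = of_int u / of_int d" "y = of_int v / of_int d"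
      "x + y = of_int (u + v) / of_int d"
    using x y by (simp_all add: u_def v_def d_def field_simps)
  have nz: "u \<noteq> 0" "v \<noteq> 0" "u + v \<noteq> 0" "d \<noteq> 0"
    using False xy x y by (auto simp: d_def)
  let ?m = "multiplicity (int p)"
  have "int p ^ min (?m u) (?m v) dvd u + v"
    by (intro dvd_add multiplicity_dvd') auto
  then have "min (?m u) (?m v) \<le> ?m (u + v)"
    using nz prime_int by (intro multiplicity_geI) auto
  then have "min (real (?m u)) (real (?m v)) \<le> real (?m (u + v))"
    by linarith
  then have "min (vp p x) (vp p y) \<le> vp p (x + y)"
    using vp_frac[of u d] vp_frac[of v d] vp_frac[of "u + v" d] nz xy
    by (auto simp: min_def split: if_splits)
  then show ?thesis using assms by (meson min.boundedI order_trans)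
qed

lemma vp_minus: "vp p (- x) = vp p x"
proof -
  have "multiplicity (int p) (- 1) = 0"
    by (intro multiplicity_unit_right) simp
  then have "vp p (- 1) = 0" using vp_of_int[of "-1"] by (simp add: zero_ereal_def)
  then show ?thesis using vp_mult[of "-1" x] by simp
qed

lemma vp_sum:
  assumes "\<And>i. i \<in> S \<Longrightarrow> c \<le> vp p (f i)"
  shows "c \<le> vp p (sum f S)"
  using assms by (induction S rule: infinite_finite_induct) (auto intro!: vp_add)

lemma vp_prod:
  "vp p (prod f S) = (\<Sum>i\<in>S. vp p (f i))"
proof (induction S rule: infinite_finite_induct)
  case (insert x F)
  then show ?case by (simp add: vp_mult)
qed (use vp_of_int[of 1] in \<open>simp_all add: zero_ereal_def\<close>)

lemma vp_power_p: "vp p (of_nat p ^ e) = ereal (real e)"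
proof -
  have "multiplicity (int p) (int p ^ e) = e"
    using prime_int by (intro multiplicity_same_power) auto
  then show ?thesis using vp_of_int[of "int p ^ e"] prime by (simp add: prime_gt_0_nat)
qed

lemma vp_p: "vp p (of_nat p) = 1"
  using vp_power_p[of 1] by (simp add: one_ereal_def)

lemma vp_inverse_p: "vp p (1 / of_nat p) = - 1"
proof -
  have "multiplicity (int p) (int p) = 1"
    using prime_int by (intro multiplicity_self) auto
  then show ?thesis
    using vp_frac[of 1 "int p"] prime by (simp add: prime_gt_0_nat one_ereal_def)
qed

lemma vp_of_int_ge_iff: "ereal (real e) \<le> vp p (of_int a) \<longleftrightarrow> int p ^ e dvd a"
proof (cases "a = 0")
  case False
  then show ?thesis
    using vp_of_int[of a] power_dvd_iff_le_multiplicity[of a "int p" e] prime_gt_1_nat[OF prime]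
    by auto
qed simp

section \<open>Arithmetic in the localisation and residues modulo powers of \<open>p\<close>\<close>

lemma Zloc_of_int [simp]: "of_int a \<in> Zloc p"
  using vp_of_int_ge_iff[of 0 a] by (simp add: Zloc_def zero_ereal_def)

lemma Zloc_0 [simp]: "0 \<in> Zloc p" and Zloc_1 [simp]: "1 \<in> Zloc p"
  using Zloc_of_int[of 0] Zloc_of_int[of 1] by simp_all

lemma Zloc_add: "x \<in> Zloc p \<Longrightarrow> y \<in> Zloc p \<Longrightarrow> x + y \<in> Zloc p"
  by (auto simp: Zloc_def intro: vp_add)

lemma Zloc_uminus: "x \<in> Zloc p \<Longrightarrow> - x \<in> Zloc p"
  by (simp add: Zloc_def vp_minus)

lemma Zloc_diff: "x \<in> Zloc p \<Longrightarrow> y \<in> Zloc p \<Longrightarrow> x - y \<in> Zloc p"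
  using Zloc_add[of x "- y"] Zloc_uminus by simp

lemma Zloc_mult: "x \<in> Zloc p \<Longrightarrow> y \<in> Zloc p \<Longrightarrow> x * y \<in> Zloc p"
  by (simp add: Zloc_def vp_mult)

lemma Zloc_sum: "(\<And>i. i \<in> S \<Longrightarrow> f i \<in> Zloc p) \<Longrightarrow> sum f S \<in> Zloc p"
  by (simp add: Zloc_def vp_sum)

lemma Zloc_prod: "(\<And>i. i \<in> S \<Longrightarrow> f i \<in> Zloc p) \<Longrightarrow> prod f S \<in> Zloc p"
  by (induction S rule: infinite_finite_induct) (auto intro: Zloc_mult)

lemma Zloc_det:
  assumes "M \<in> carrier_mat n n" "\<And>i j. i < n \<Longrightarrow> j < n \<Longrightarrow> M $$ (i, j) \<in> Zloc p"
  shows "det M \<in> Zloc p"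
  unfolding det_def'[OF assms(1)]
  by (intro Zloc_sum Zloc_mult Zloc_prod)
    (auto simp: sign_def Zloc_uminus intro!: assms(2) dest: permutes_in_image)

lemma Zloc_divide:
  assumes "y \<noteq> 0" "vp p y \<le> vp p x"
  shows "x / y \<in> Zloc p"
proof -
  have "vp p x = vp p (x / y) + vp p y"
    using vp_mult[of "x / y" y] assms by simp
  moreover obtain k where "vp p y = ereal (real_of_int k)" using vp_finite assms by blast
  ultimately show ?thesis
    using assms(2) by (cases "vp p (x / y)") (auto simp: Zloc_def)
qed

lemma Zloc_vp_nat:
  assumes "x \<in> Zloc p" "x \<noteq> 0"
  obtains e :: nat where "vp p x = ereal (real e)"
proof -
  obtain k where k: "vp p x = ereal (real_of_int k)" using vp_finite assms by blast
  then have "k \<ge> 0" using assms by (simp add: Zloc_def)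
  then have "vp p x = ereal (real (nat k))" using k by simp
  then show ?thesis by (rule that)
qed

lemma Zloc_frac:
  assumes "x \<in> Zloc p"
  obtains a b where "x = of_int a / of_int b" "\<not> int p dvd b"
proof (cases "x = 0")
  case True
  then show ?thesis using that[of 0 1] prime_gt_1_nat[OF prime] by auto
next
  case False
  obtain a b where q: "quotient_of x = (a, b)" by (cases "quotient_of x")
  have x: "x = of_int a / of_int b" and b: "b > 0" and cop: "coprime a b"
    using q quotient_of_div quotient_of_denom_pos quotient_of_coprime by blast+
  have "\<not> int p dvd b"
  proof
    assume pb: "int p dvd b"
    then have "\<not> int p dvd a"
      using cop prime_int by (meson coprime_common_divisor not_prime_unit)
    then have "multiplicity (int p) a = 0" by (rule not_dvd_imp_multiplicity_0)
    moreover have "multiplicity (int p) b \<ge> 1"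
      using pb b prime_int by (intro multiplicity_geI) auto
    ultimately show False
      using assms vp_frac[of a b] x b False by (auto simp: Zloc_def)
  qed
  then show ?thesis using that x by blast
qed

text \<open>The denominator is prime to \<open>p\<close>, so Bezout provides an inverse
  \<open>c\<close> of it modulo \<open>p ^ e\<close>; the residue is \<open>a * c mod p ^ e\<close>.
  The case \<open>e = 1\<close> later identifies \<open>residue\<close>, and general
  \<open>e\<close> gives coset representatives.\<close>

lemma Zloc_residue:
  assumes "x \<in> Zloc p"
  obtains r where "0 \<le> r" "r < int p ^ e" "ereal (real e) \<le> vp p (x - of_int r)"
proof -
  obtain a b where x: "x = of_int a / of_int b" and b: "\<not> int p dvd b"
    using Zloc_frac assms by blast
  have "coprime b (int p ^ e)"
    using b prime_int by (metis coprime_commute coprime_power_left_iff prime_imp_coprime)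
  then obtain c d where cd: "c * b + d * int p ^ e = 1"
    by (metis coprime_iff_gcd_eq_1 bezout_int)
  define r where "r = a * c mod int p ^ e"
  have pos: "int p ^ e > 0" using prime by (simp add: prime_gt_0_nat)
  have b0: "b \<noteq> 0" using b by auto
  have "int p ^ e dvd a * c - r"
    unfolding r_def by (metis dvd_minus_mod)
  then have "int p ^ e dvd (a * c - r) * b + a * d * int p ^ e"
    by simp
  moreover have "(a * c - r) * b + a * d * int p ^ e = a * (c * b + d * int p ^ e) - r * b"
    by (simp add: algebra_simps)
  ultimately have "int p ^ e dvd a - r * b"
    using cd by simp
  then have "ereal (real e) \<le> vp p (of_int (a - r * b))"
    by (simp only: vp_of_int_ge_iff)
  also have "\<dots> = vp p ((x - of_int r) * of_int b)"
    using x b0 by (simp add: algebra_simps)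
  also have "\<dots> = vp p (x - of_int r)"
    using vp_of_int[OF b0] not_dvd_imp_multiplicity_0[OF b] vp_mult[of _ "of_int b"]
    by (simp add: zero_ereal_def[symmetric])
  finally show ?thesis
    using that[of r] pos by (simp add: r_def)
qed

end

section \<open>Lattices over the localisation\<close>

text \<open>The \<open>Zloc p\<close>-span of the columns of \<open>Q\<close>. Vectors are functions
  on all naturals, but membership depends only on the coordinates below \<open>n\<close>.\<close>

definition zlattice :: "nat \<Rightarrow> nat \<Rightarrow> rat mat \<Rightarrow> (nat \<Rightarrow> rat) set" where
  "zlattice p n Q = {x. \<exists>z. (\<forall>j<n. z j \<in> Zloc p) \<and> (\<forall>i<n. x i = (\<Sum>j<n. Q $$ (i, j) * z j))}"

lemma mat_mult_index_sum:
  assumes "M \<in> carrier_mat n k" "N \<in> carrier_mat k l" "i < n" "j < l"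
  shows "(M * N) $$ (i, j) = (\<Sum>t<k. M $$ (i, t) * N $$ (t, j))"
  using assms by (auto simp: scalar_prod_def atLeast0LessThan intro!: sum.cong)

context
  fixes p :: nat
  assumes prime: "prime p"
begin

lemma zlattice_add_smult:
  assumes "x \<in> zlattice p n Q" "y \<in> zlattice p n Q" "c \<in> Zloc p"
  shows "(\<lambda>i. x i + c * y i) \<in> zlattice p n Q"
proof -
  obtain z w where z: "\<forall>j<n. z j \<in> Zloc p" "\<forall>i<n. x i = (\<Sum>j<n. Q $$ (i, j) * z j)"
    and w: "\<forall>j<n. w j \<in> Zloc p" "\<forall>i<n. y i = (\<Sum>j<n. Q $$ (i, j) * w j)"
    using assms by (auto simp: zlattice_def)
  show ?thesis
    unfolding zlattice_def
  proof (intro CollectI exI[of _ "\<lambda>j. z j + c * w j"] conjI allI impI)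
    fix j assume "j < n"
    then show "z j + c * w j \<in> Zloc p"
      using z w assms(3) by (auto intro!: Zloc_add[OF prime] Zloc_mult[OF prime])
  next
    fix i assume "i < n"
    then show "x i + c * y i = (\<Sum>j<n. Q $$ (i, j) * (z j + c * w j))"
      using z w by (simp add: distrib_left sum.distrib sum_distrib_left mult.left_commute)
  qed
qed

lemma zlattice_diff_smult:
  assumes "x \<in> zlattice p n Q" "y \<in> zlattice p n Q" "c \<in> Zloc p"
  shows "(\<lambda>i. x i - c * y i) \<in> zlattice p n Q"
  using zlattice_add_smult[OF assms(1,2) Zloc_uminus[OF prime assms(3)]] by simp

lemma zlattice_sum:
  fixes k :: nat
  assumes "\<And>j. j < k \<Longrightarrow> t j \<in> zlattice p n Q" "\<And>j. j < k \<Longrightarrow> c j \<in> Zloc p"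
  shows "(\<lambda>i. \<Sum>j<k. c j * t j i) \<in> zlattice p n Q"
  using assms
proof (induction k)
  case 0
  have "\<exists>z. (\<forall>j<n. z j \<in> Zloc p) \<and> (\<forall>i<n. 0 = (\<Sum>j<n. Q $$ (i, j) * z j))"
    by (rule exI[of _ "\<lambda>_. 0"]) (simp add: Zloc_0[OF prime])
  then show ?case by (simp add: zlattice_def)
next
  case (Suc k)
  then show ?case using zlattice_add_smult[of _ n Q "t k" "c k"] by simp
qed

lemma zlattice_column:
  assumes "j < n"
  shows "(\<lambda>i. Q $$ (i, j)) \<in> zlattice p n Q"
proof -
  have "(\<Sum>l<n. Q $$ (i, l) * (if l = j then 1 else 0)) = Q $$ (i, j)" for i
    using assms by (simp add: if_distrib[of "\<lambda>a. _ * a"] cong: if_cong)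
  then show ?thesis
    unfolding zlattice_def
    by (intro CollectI exI[of _ "\<lambda>l. if l = j then 1 else 0"])
       (auto simp: Zloc_0[OF prime] Zloc_1[OF prime])
qed

text \<open>The \<open>k\<close>-th entry of \<open>t k\<close> has least valuation among the lattice vectors supported in rows
  \<open>\<ge> k\<close>. Hence \<open>Q = T U\<close> with \<open>U\<close> integral, which gives the bound on \<open>det Q\<close>.\<close>

lemma zlattice_triangular_basis:
  assumes Q: "Q \<in> carrier_mat n n"
    and int: "\<And>i j. i < n \<Longrightarrow> j < n \<Longrightarrow> Q $$ (i, j) \<in> Zloc p"
    and det: "det Q \<noteq> 0"
  obtains t :: "nat \<Rightarrow> nat \<Rightarrow> rat" and v :: "nat \<Rightarrow> nat" where
    "\<And>k. k < n \<Longrightarrow> t k \<in> zlattice p n Q"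
    "\<And>k i. k < n \<Longrightarrow> i < k \<Longrightarrow> t k i = 0"
    "\<And>k. k < n \<Longrightarrow> vp p (t k k) = ereal (real (v k))"
    "ereal (real (\<Sum>k<n. v k)) \<le> vp p (det Q)"
proof -
  define L where "L k = {x \<in> zlattice p n Q. \<forall>i<k. x i = 0}" for k
  have ent: "x i \<in> Zloc p" if "x \<in> zlattice p n Q" "i < n" for x i
    using that int by (auto simp: zlattice_def intro!: Zloc_sum[OF prime] Zloc_mult[OF prime])
  have ex: "\<exists>e x. x \<in> L k \<and> vp p (x k) = ereal (real e)" if k: "k < n" for k
  proof -
    note adj = adj_mat[OF Q]
    \<comment> \<open>\<open>N\<close> is a common denominator of column \<open>k\<close> of the
      adjugate. Then \<open>N * det Q\<close> times the \<open>k\<close>-th unit vector is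
      \<open>Q\<close> applied to an integral vector, so \<open>L k\<close> contains a vector with
      nonzero \<open>k\<close>-th entry.\<close>
    obtain N where N: "N \<noteq> 0" "\<And>j. j < n \<Longrightarrow> of_int N * adj_mat Q $$ (j, k) \<in> Zloc p"
    proof -
      define D where "D j = snd (quotient_of (adj_mat Q $$ (j, k)))" for j
      have D: "D j \<noteq> 0" "adj_mat Q $$ (j, k) = of_int (fst (quotient_of (adj_mat Q $$ (j, k)))) / of_int (D j)" for j
        unfolding D_def using quotient_of_denom_pos'[of "adj_mat Q $$ (j, k)"]
          quotient_of_div[of "adj_mat Q $$ (j, k)"] by (auto simp: prod_eq_iff)
      have "of_int (\<Prod>j<n. D j) * adj_mat Q $$ (j, k) \<in> Zloc p" if "j < n" for j
      proof -
        have "(\<Prod>j<n. D j) = D j * (\<Prod>l\<in>{..<n} - {j}. D l)"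
          using that by (intro prod.remove) auto
        then have "of_int (\<Prod>j<n. D j) * adj_mat Q $$ (j, k)
          = of_int (fst (quotient_of (adj_mat Q $$ (j, k))) * (\<Prod>l\<in>{..<n} - {j}. D l))"
          using D[of j] by (simp add: field_simps del: of_int_prod)
        then show ?thesis by (simp only: Zloc_of_int[OF prime])
      qed
      then show ?thesis using that[of "\<Prod>j<n. D j"] D(1) by auto
    qed
    define x where "x i = (if i = k then of_int N * det Q else 0)" for i :: nat
    have "x \<in> zlattice p n Q"
      unfolding zlattice_def
    proof (intro CollectI exI[of _ "\<lambda>j. of_int N * adj_mat Q $$ (j, k)"] conjI allI impI N(2))
      fix i assume i: "i < n"
      have "(\<Sum>j<n. Q $$ (i, j) * adj_mat Q $$ (j, k)) = (Q * adj_mat Q) $$ (i, k)"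
        using mat_mult_index_sum[OF Q adj(1) i k] by simp
      also have "\<dots> = (if i = k then det Q else 0)"
        unfolding adj(2) using i k by simp
      finally show "x i = (\<Sum>j<n. Q $$ (i, j) * (of_int N * adj_mat Q $$ (j, k)))"
        by (simp add: x_def sum_distrib_left[symmetric] mult.left_commute)
    qed
    then have "x \<in> L k" by (simp add: L_def x_def)
    moreover have "x k \<noteq> 0" using det N by (simp add: x_def)
    ultimately show ?thesis
      using Zloc_vp_nat[OF prime, of "x k"] ent[OF \<open>x \<in> zlattice p n Q\<close> k] by blast
  qed
  \<comment> \<open>Lattice vectors have \<open>p\<close>-integral entries, so nonzero entries have
    natural numbers as valuations and the minimum is attained.\<close>
  define v where "v k = (LEAST e. \<exists>x. x \<in> L k \<and> vp p (x k) = ereal (real e))" for k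
  have "\<exists>x. x \<in> L k \<and> vp p (x k) = ereal (real (v k))" if "k < n" for k
    unfolding v_def using ex[OF that] by (rule LeastI_ex)
  then obtain t where t: "\<And>k. k < n \<Longrightarrow> t k \<in> L k \<and> vp p (t k k) = ereal (real (v k))"
    by metis
  have t0: "t k k \<noteq> 0" if "k < n" for k
    using t[OF that] by auto
  have least: "ereal (real (v k)) \<le> vp p (x k)" if x: "x \<in> L k" and k: "k < n" for x k
  proof (cases "x k = 0")
    case False
    have "x \<in> zlattice p n Q" using x by (simp add: L_def)
    then obtain e where e: "vp p (x k) = ereal (real e)"
      using Zloc_vp_nat[OF prime, of "x k"] ent[of x k] False k by blast
    then have "v k \<le> e" unfolding v_def using x by (intro Least_le) auto
    then show ?thesis using e by simp
  qed simp
  \<comment> \<open>Elimination from the top: \<open>t k k\<close> has least valuation among the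
    possible entries in row \<open>k\<close>, so the quotient \<open>y k / t k k\<close> is
    \<open>p\<close>-integral and subtracting that multiple of \<open>t k\<close> clears row
    \<open>k\<close>.\<close>
  have expand: "\<exists>z. (\<forall>j<k. z j \<in> Zloc p) \<and> (\<lambda>i. x i - (\<Sum>j<k. z j * t j i)) \<in> L k"
    if x: "x \<in> zlattice p n Q" and "k \<le> n" for x k
    using \<open>k \<le> n\<close>
  proof (induction k)
    case 0
    then show ?case using x by (simp add: L_def)
  next
    case (Suc k)
    then obtain z where z: "\<forall>j<k. z j \<in> Zloc p"
      and y: "(\<lambda>i. x i - (\<Sum>j<k. z j * t j i)) \<in> L k" by auto
    define y where "y = (\<lambda>i. x i - (\<Sum>j<k. z j * t j i))"
    have yL: "y \<in> L k" using y by (simp add: y_def)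
    have k: "k < n" using Suc by simp
    define c where "c = y k / t k k"
    have c: "c \<in> Zloc p"
      unfolding c_def using least[OF yL k] t[OF k] t0[OF k] by (intro Zloc_divide[OF prime]) auto
    have "(\<lambda>i. y i - c * t k i) \<in> L (Suc k)"
      using zlattice_diff_smult[of y n Q "t k" c] c yL t[OF k] t0[OF k]
      by (auto simp: L_def c_def less_Suc_eq)
    moreover have "(\<lambda>i. y i - c * t k i) = (\<lambda>i. x i - (\<Sum>j<Suc k. (z(k := c)) j * t j i))"
      by (simp add: y_def fun_eq_iff)
    ultimately show ?case
      using z c by (intro exI[of _ "z(k := c)"]) (auto simp: less_Suc_eq)
  qed
  have "\<exists>z. (\<forall>l<n. z l \<in> Zloc p) \<and> (\<forall>i<n. Q $$ (i, j) = (\<Sum>l<n. z l * t l i))" if "j < n" for j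
    using expand[OF zlattice_column[OF that] order_refl] by (auto simp: L_def)
  then obtain u where u: "\<And>j l. j < n \<Longrightarrow> l < n \<Longrightarrow> u j l \<in> Zloc p"
    "\<And>i j. i < n \<Longrightarrow> j < n \<Longrightarrow> Q $$ (i, j) = (\<Sum>l<n. u j l * t l i)"
    by metis
  define T where "T = mat n n (\<lambda>(i, l). t l i)"
  define U where "U = mat n n (\<lambda>(l, j). u j l)"
  have TU: "T \<in> carrier_mat n n" "U \<in> carrier_mat n n" by (auto simp: T_def U_def)
  have "Q = T * U"
  proof (rule eq_matI)
    fix i j assume "i < dim_row (T * U)" "j < dim_col (T * U)"
    then have ij: "i < n" "j < n" using TU by auto
    then show "Q $$ (i, j) = (T * U) $$ (i, j)"
      unfolding mat_mult_index_sum[OF TU ij] u(2)[OF ij]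
      by (intro sum.cong) (auto simp: T_def U_def)
  qed (use Q TU in auto)
  then have "det Q = det T * det U" using det_mult[OF TU] by simp
  moreover have "det T = (\<Prod>k<n. t k k)"
  proof -
    have "det T = prod_list (diag_mat T)"
      using t by (intro det_lower_triangular[OF _ TU(1)]) (auto simp: T_def L_def)
    also have "\<dots> = (\<Prod>k<n. t k k)"
      unfolding prod_list_diag_prod by (auto simp: T_def atLeast0LessThan intro!: prod.cong)
    finally show ?thesis .
  qed
  moreover have "vp p (\<Prod>k<n. t k k) = ereal (real (\<Sum>k<n. v k))"
    unfolding vp_prod[OF prime] using t by (simp add: sum_ereal)
  moreover have "vp p (det U) \<ge> 0"
    using Zloc_det[OF prime TU(2)] u(1) by (auto simp: U_def Zloc_def)
  ultimately have "ereal (real (\<Sum>k<n. v k)) \<le> vp p (det Q)"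
    by (metis add.right_neutral add_left_mono vp_mult[OF prime])
  then show ?thesis
    using that[of t v] t by (auto simp: L_def)
qed

text \<open>The index of the lattice among integer vectors, expressed by a map \<open>\<phi>\<close>
  with finite range whose fibres lie in cosets. \<open>\<phi> x\<close> is the remainder of
  \<open>x\<close> after division by the triangular basis, a point of the box with sides
  \<open>p ^ v k\<close>.\<close>

lemma zlattice_index:
  assumes Q: "Q \<in> carrier_mat n n"
    and int: "\<And>i j. i < n \<Longrightarrow> j < n \<Longrightarrow> Q $$ (i, j) \<in> Zloc p"
    and det: "det Q \<noteq> 0"
  obtains \<phi> :: "(nat \<Rightarrow> int) \<Rightarrow> (nat \<Rightarrow> int)" and V :: nat where
    "finite (range \<phi>)" "card (range \<phi>) \<le> p ^ V" "ereal (real V) \<le> vp p (det Q)"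
    "\<And>x y. \<phi> x = \<phi> y \<Longrightarrow> (\<lambda>i. of_int (x i - y i)) \<in> zlattice p n Q"
proof -
  obtain t :: "nat \<Rightarrow> nat \<Rightarrow> rat" and v :: "nat \<Rightarrow> nat" where
    tL: "\<And>k. k < n \<Longrightarrow> t k \<in> zlattice p n Q" and
    tz: "\<And>k i. k < n \<Longrightarrow> i < k \<Longrightarrow> t k i = 0" and
    tv: "\<And>k. k < n \<Longrightarrow> vp p (t k k) = ereal (real (v k))" and
    V: "ereal (real (\<Sum>k<n. v k)) \<le> vp p (det Q)"
    using zlattice_triangular_basis[OF assms] by blast
  define B where "B = PiE {..<n} (\<lambda>k. {0..<int p ^ v k})"
  have tint: "t k i \<in> Zloc p" if "k < n" "i < n" for k i
    using that tL[of k] int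
    by (auto simp: zlattice_def intro!: Zloc_sum[OF prime] Zloc_mult[OF prime])
  \<comment> \<open>Coordinate \<open>k\<close> is treated after the earlier ones; subtracting a
    multiple of \<open>t k\<close> does not disturb them, because \<open>t k\<close> vanishes in
    rows below \<open>k\<close>.\<close>
  have red: "\<exists>z r. (\<forall>j<k. z j \<in> Zloc p) \<and> (\<forall>i<k. r i \<in> {0..<int p ^ v i}) \<and>
      (\<forall>i<k. of_int (x i) = of_int (r i) + (\<Sum>j<k. z j * t j i))"
    if "k \<le> n" for x :: "nat \<Rightarrow> int" and k
    using that
  proof (induction k)
    case (Suc k)
    then obtain z r where z: "\<forall>j<k. z j \<in> Zloc p" and r: "\<forall>i<k. r i \<in> {0..<int p ^ v i}"
      and x: "\<forall>i<k. of_int (x i) = of_int (r i) + (\<Sum>j<k. z j * t j i)" by auto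
    have k: "k < n" using Suc by simp
    define w where "w = of_int (x k) - (\<Sum>j<k. z j * t j k)"
    have "w \<in> Zloc p"
      unfolding w_def using z tint k
      by (intro Zloc_diff[OF prime] Zloc_of_int[OF prime] Zloc_sum[OF prime] Zloc_mult[OF prime]) auto
    then obtain \<rho> where \<rho>: "0 \<le> \<rho>" "\<rho> < int p ^ v k" "ereal (real (v k)) \<le> vp p (w - of_int \<rho>)"
      using Zloc_residue[OF prime] by blast
    define c where "c = (w - of_int \<rho>) / t k k"
    have tk: "t k k \<noteq> 0" using tv[OF k] by auto
    have "c \<in> Zloc p"
      unfolding c_def using \<rho> tv[OF k] tk by (intro Zloc_divide[OF prime]) auto
    moreover have "of_int (x k) = of_int \<rho> + ((\<Sum>j<k. z j * t j k) + c * t k k)"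
      using tk by (simp add: c_def w_def)
    ultimately show ?case
      using z r x \<rho> tz[OF k]
      by (intro exI[of _ "z(k := c)"] exI[of _ "r(k := \<rho>)"]) (auto simp: less_Suc_eq)
  qed auto
  have "\<exists>f z. (\<forall>j<n. z j \<in> Zloc p) \<and> f \<in> B \<and>
      (\<forall>i<n. of_int (x i) = of_int (f i) + (\<Sum>j<n. z j * t j i))" for x :: "nat \<Rightarrow> int"
  proof -
    obtain z r where zr: "\<forall>j<n. z j \<in> Zloc p" "\<forall>i<n. r i \<in> {0..<int p ^ v i}"
      "\<forall>i<n. of_int (x i) = of_int (r i) + (\<Sum>j<n. z j * t j i)"
      using red[OF order_refl, of x] by blast
    then show ?thesis
      by (intro exI[of _ "restrict r {..<n}"] exI[of _ z]) (auto simp: B_def)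
  qed
  then obtain \<phi> z where z: "\<And>x j. j < n \<Longrightarrow> z x j \<in> Zloc p" and \<phi>: "\<And>x. \<phi> x \<in> B"
    and eq: "\<And>(x :: nat \<Rightarrow> int) i. i < n \<Longrightarrow> of_int (x i) = of_int (\<phi> x i) + (\<Sum>j<n. z x j * t j i)"
    by metis
  have B: "finite B" "card B = p ^ (\<Sum>k<n. v k)"
    by (auto simp: B_def card_PiE power_sum nat_power_eq intro!: finite_PiE)
  have sub: "range \<phi> \<subseteq> B" using \<phi> by auto
  have "(\<lambda>i. of_int (x i - y i)) \<in> zlattice p n Q" if xy: "\<phi> x = \<phi> y" for x y
  proof -
    have "(\<lambda>i. \<Sum>j<n. (z x j - z y j) * t j i) \<in> zlattice p n Q"
      using tL z by (intro zlattice_sum Zloc_diff[OF prime]) auto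
    moreover have "of_int (x i - y i) = (\<Sum>j<n. (z x j - z y j) * t j i)" if "i < n" for i
      using eq[OF that, of x] eq[OF that, of y] xy
      by (simp add: left_diff_distrib sum_subtractf)
    ultimately show ?thesis by (simp add: zlattice_def)
  qed
  then show ?thesis
    using that[of \<phi> "\<Sum>k<n. v k"] V B finite_subset[OF sub] card_mono[OF _ sub] by auto
qed

end

section \<open>A weak form of Minkowski's second theorem\<close>

definition dot :: "nat \<Rightarrow> (nat \<Rightarrow> real) \<Rightarrow> (nat \<Rightarrow> real) \<Rightarrow> real" where
  "dot n x y = (\<Sum>i<n. x i * y i)"

lemma dot_diff_sum_left:
  "dot n (\<lambda>k. x k - (\<Sum>j\<in>J. c j * f j k)) y = dot n x y - (\<Sum>j\<in>J. c j * dot n (f j) y)"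
proof -
  have "(\<Sum>i<n. (\<Sum>j\<in>J. c j * f j i) * y i) = (\<Sum>j\<in>J. c j * (\<Sum>i<n. f j i * y i))"
    unfolding sum_distrib_right sum_distrib_left
    by (subst sum.swap) (simp add: mult.assoc)
  then show ?thesis
    by (simp add: dot_def left_diff_distrib sum_subtractf)
qed

lemma dot_sum_left:
  assumes "\<And>k. k < n \<Longrightarrow> x k = (\<Sum>j\<in>J. c j * f j k)"
  shows "dot n x y = (\<Sum>j\<in>J. c j * dot n (f j) y)"
proof -
  have "dot n x y = (\<Sum>i<n. \<Sum>j\<in>J. c j * f j i * y i)"
    by (simp add: dot_def assms sum_distrib_right)
  also have "\<dots> = (\<Sum>j\<in>J. c j * dot n (f j) y)"
    by (subst sum.swap) (simp add: dot_def sum_distrib_left mult.assoc)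
  finally show ?thesis .
qed

lemma dot_commute: "dot n x y = dot n y x"
  by (simp add: dot_def mult.commute)

lemma dot_smult_right: "dot n x (\<lambda>k. c * y k) = c * dot n x y"
  by (simp add: dot_def sum_distrib_left mult.left_commute)

lemma dot_self_zero_iff: "dot n x x = 0 \<longleftrightarrow> (\<forall>k<n. x k = 0)"
  by (simp add: dot_def sum_nonneg_eq_0_iff Ball_def)

text \<open>Allowing \<open>e i = 0\<close> makes linear independence of the \<open>b i\<close> superfluous.\<close>

lemma gram_schmidt_prefix:
  fixes b :: "nat \<Rightarrow> nat \<Rightarrow> real"
  shows "\<exists>e. (\<forall>i<m. \<forall>j<m. i \<noteq> j \<longrightarrow> dot n (e i) (e j) = 0) \<and>
    (\<forall>i<m. dot n (e i) (e i) = 1 \<or> (\<forall>k. e i k = 0)) \<and>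
    (\<forall>i<m. \<forall>k<n. b i k = (\<Sum>j\<le>i. dot n (b i) (e j) * e j k))"
proof (induction m)
  case (Suc m)
  then obtain e where e: "(\<forall>i<m. \<forall>j<m. i \<noteq> j \<longrightarrow> dot n (e i) (e j) = 0) \<and>
    (\<forall>i<m. dot n (e i) (e i) = 1 \<or> (\<forall>k. e i k = 0)) \<and>
    (\<forall>i<m. \<forall>k<n. b i k = (\<Sum>j\<le>i. dot n (b i) (e j) * e j k))" ..
  then have orth: "dot n (e i) (e j) = 0" if "i < m" "j < m" "i \<noteq> j" for i j
    using that by metis
  from e have unit: "dot n (e i) (e i) = 1 \<or> (\<forall>k. e i k = 0)" if "i < m" for i
    using that by metis
  from e have exp: "b i k = (\<Sum>j\<le>i. dot n (b i) (e j) * e j k)" if "i < m" "k < n" for i k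
    using that by metis
  define w where "w = (\<lambda>k. b m k - (\<Sum>j<m. dot n (b m) (e j) * e j k))"
  have w: "dot n w (e i) = 0" if i: "i < m" for i
  proof -
    have "(\<Sum>j<m. dot n (b m) (e j) * dot n (e j) (e i))
        = (\<Sum>j<m. if j = i then dot n (b m) (e i) * dot n (e i) (e i) else 0)"
      using orth i by (intro sum.cong) auto
    also have "\<dots> = dot n (b m) (e i) * dot n (e i) (e i)"
      using i by simp
    also have "\<dots> = dot n (b m) (e i)"
      using unit[OF i] by (auto simp: dot_def)
    finally show ?thesis by (simp add: w_def dot_diff_sum_left)
  qed
  define s where "s = sqrt (dot n w w)"
  \<comment> \<open>If \<open>s = 0\<close>, the factor 0 makes \<open>u\<close> the zero vector,
    and \<open>w k = s * u k\<close> still holds for \<open>k < n\<close> since \<open>w\<close>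
    vanishes there.\<close>
  define t where "t = (if s = 0 then 0 else 1 / s)"
  define u where "u = (\<lambda>k. t * w k)"
  have s2: "s * s = dot n w w"
    by (simp add: s_def dot_def sum_nonneg)
  have dotu: "dot n x u = t * dot n x w" for x
    unfolding u_def by (rule dot_smult_right)
  have u0: "dot n u (e i) = 0" if "i < m" for i
    using w[OF that] by (simp add: dot_commute[of n u] dotu dot_commute[of n "e i"])
  have uw: "dot n w u = s"
    using s2 by (auto simp: dotu t_def field_simps)
  have uu: "dot n u u = 1 \<or> (\<forall>k. u k = 0)"
    unfolding dotu[of u] dot_commute[of n u w] uw by (auto simp: t_def u_def)
  have su: "w k = s * u k" if "k < n" for k
    using s2 dot_self_zero_iff[of n w] that by (auto simp: u_def t_def)
  have bw: "b m k = w k + (\<Sum>j<m. dot n (b m) (e j) * e j k)" for k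
    by (simp add: w_def)
  have "dot n (b m) u = s"
  proof -
    have "dot n w u = dot n (b m) u - (\<Sum>j<m. dot n (b m) (e j) * dot n (e j) u)"
      unfolding w_def by (rule dot_diff_sum_left)
    then show ?thesis using uw u0 by (simp add: dot_commute)
  qed
  define e' where "e' = e(m := u)"
  have e': "e' m = u" "\<And>i. i < m \<Longrightarrow> e' i = e i" by (auto simp: e'_def)
  have new: "b m k = (\<Sum>j\<le>m. dot n (b m) (e' j) * e' j k)" if "k < n" for k
  proof -
    have "(\<Sum>j\<le>m. dot n (b m) (e' j) * e' j k) = (\<Sum>j<m. dot n (b m) (e j) * e j k) + s * u k"
      unfolding lessThan_Suc_atMost[symmetric] sum.lessThan_Suc
      using \<open>dot n (b m) u = s\<close> by (simp add: e')
    then show ?thesis using bw[of k] su[OF that] by linarith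
  qed
  have old: "b i k = (\<Sum>j\<le>i. dot n (b i) (e' j) * e' j k)" if "k < n" "i < m" for i k
    unfolding exp[OF that(2,1)] using that(2) by (intro sum.cong) (auto simp: e')
  have 1: "dot n (e' i) (e' j) = 0" if "i < Suc m" "j < Suc m" "i \<noteq> j" for i j
    using that orth[of i j] u0[of i] u0[of j] by (auto simp: less_Suc_eq dot_commute[of n _ u] e')
  have 2: "dot n (e' i) (e' i) = 1 \<or> (\<forall>k. e' i k = 0)" if "i < Suc m" for i
    using that unit[of i] uu by (auto simp: less_Suc_eq e')
  have 3: "b i k = (\<Sum>j\<le>i. dot n (b i) (e' j) * e' j k)" if "i < Suc m" "k < n" for i k
    using that old[of k i] new[of k] by (cases "i = m") auto
  show ?case
    using 1 2 3 by (intro exI[of _ e'] conjI allI impI)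
qed simp

text \<open>Each \<open>b j\<close> is orthogonal to all later \<open>e l\<close>, so
  \<open>x\<close> expands in \<open>e 0, ..., e i\<close> with coefficients
  \<open>dot n x (e l)\<close>. Pairing this expansion with \<open>x\<close> gives the sum of
  squares, also when some \<open>e l\<close> are zero.\<close>

lemma gram_schmidt_parseval:
  fixes b e :: "nat \<Rightarrow> nat \<Rightarrow> real"
  assumes orth: "\<And>i j. i < m \<Longrightarrow> j < m \<Longrightarrow> i \<noteq> j \<Longrightarrow> dot n (e i) (e j) = 0"
    and exp: "\<And>i k. i < m \<Longrightarrow> k < n \<Longrightarrow> b i k = (\<Sum>j\<le>i. dot n (b i) (e j) * e j k)"
    and i: "i < m" and x: "\<And>k. k < n \<Longrightarrow> x k = (\<Sum>j\<le>i. c j * b j k)"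
  shows "dot n x x = (\<Sum>l\<le>i. (dot n x (e l))\<^sup>2)"
proof -
  have tri: "dot n (b j) (e l) = 0" if "j < l" "l < m" for j l
  proof -
    have "dot n (b j) (e l) = (\<Sum>t\<le>j. dot n (b j) (e t) * dot n (e t) (e l))"
      using that less_trans[OF that] by (intro dot_sum_left exp) auto
    also have "\<dots> = 0" using orth that by (intro sum.neutral) auto
    finally show ?thesis .
  qed
  have xe: "dot n x (e l) = (\<Sum>j\<le>i. c j * dot n (b j) (e l))" for l
    using x by (rule dot_sum_left)
  have "x k = (\<Sum>l\<le>i. dot n x (e l) * e l k)" if k: "k < n" for k
  proof -
    have "b j k = (\<Sum>l\<le>i. dot n (b j) (e l) * e l k)" if "j \<le> i" for j
    proof -
      have "b j k = (\<Sum>l\<le>j. dot n (b j) (e l) * e l k)"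
        using exp that i k by simp
      also have "\<dots> = (\<Sum>l\<le>i. dot n (b j) (e l) * e l k)"
        using that tri i by (intro sum.mono_neutral_left) auto
      finally show ?thesis .
    qed
    then have "x k = (\<Sum>j\<le>i. \<Sum>l\<le>i. c j * dot n (b j) (e l) * e l k)"
      by (simp add: x[OF k] sum_distrib_left mult.assoc)
    also have "\<dots> = (\<Sum>l\<le>i. dot n x (e l) * e l k)"
      by (subst sum.swap) (simp add: xe sum_distrib_right)
    finally show ?thesis .
  qed
  then have "dot n x x = (\<Sum>l\<le>i. dot n x (e l) * dot n (e l) x)"
    by (rule dot_sum_left)
  then show ?thesis by (simp add: dot_commute power2_eq_square)
qed

section \<open>Pigeonhole principle for several linear forms\<close>

lemma card_floor_interval:
  fixes a b c :: real
  assumes "c > 0" "a \<le> b"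
  shows "real (card {\<lfloor>a / c\<rfloor>..\<lfloor>b / c\<rfloor>}) \<le> (b - a) / c + 2"
proof -
  have "\<lfloor>a / c\<rfloor> \<le> \<lfloor>b / c\<rfloor>" using assms by (intro floor_mono divide_right_mono) auto
  then have "real (card {\<lfloor>a / c\<rfloor>..\<lfloor>b / c\<rfloor>}) = of_int \<lfloor>b / c\<rfloor> - of_int \<lfloor>a / c\<rfloor> + 1"
    by simp
  also have "\<dots> \<le> b / c - a / c + 2" by linarith
  finally show ?thesis by (simp add: diff_divide_distrib)
qed

text \<open>Siegel's pigeonhole argument on the cube \<open>[0, R)\<^sup>n\<close> for large \<open>R\<close>.\<close>

lemma minkowski_linear_forms:
  fixes \<phi> :: "(nat \<Rightarrow> int) \<Rightarrow> 'c" and e :: "nat \<Rightarrow> nat \<Rightarrow> real" and c :: "nat \<Rightarrow> real"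
  assumes fin: "finite (range \<phi>)"
    and e: "\<And>i. i < n \<Longrightarrow> dot n (e i) (e i) \<le> 1"
    and c: "\<And>i. i < n \<Longrightarrow> c i > 0"
    and big: "sqrt (real n) ^ n * real (card (range \<phi>)) < (\<Prod>i<n. c i)"
  obtains x y where "\<phi> x = \<phi> y" "\<exists>i<n. x i \<noteq> y i"
    "\<And>i. i < n \<Longrightarrow> \<bar>dot n (\<lambda>k. real_of_int (x k - y k)) (e i)\<bar> < c i"
proof -
  let ?I = "real (card (range \<phi>))"
  \<comment> \<open>This product bounds the number of pigeonholes divided by the number
    \<open>R ^ n\<close> of points. Its limit is below 1 by \<open>big\<close>, so a finite
    \<open>R\<close> absorbs the rounding errors 2.\<close>
  have "(\<lambda>R. (\<Prod>i<n. sqrt (real n) / c i + 2 / real R) * ?I)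
      \<longlonglongrightarrow> (\<Prod>i<n. sqrt (real n) / c i + 0) * ?I"
    by (intro tendsto_intros lim_const_over_n)
  moreover have "(\<Prod>i<n. sqrt (real n) / c i + 0) * ?I < 1"
    using big prod_pos[of "{..<n}" c] c by (simp add: prod_dividef)
  ultimately have "\<forall>\<^sub>F R in sequentially. (\<Prod>i<n. sqrt (real n) / c i + 2 / real R) * ?I < 1"
    by (rule order_tendstoD)
  then have "\<forall>\<^sub>F R in sequentially. (\<Prod>i<n. sqrt (real n) / c i + 2 / real R) * ?I < 1 \<and> R > 0"
    using eventually_gt_at_top by (rule eventually_conj)
  then obtain R :: nat where R0: "R > 0"
    and R: "(\<Prod>i<n. sqrt (real n) / c i + 2 / real R) * ?I < 1"
    unfolding eventually_sequentially by blast
  have R': "(\<Prod>i<n. sqrt (real n) * real R / c i + 2) * ?I < real R ^ n"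
  proof -
    have "(\<Prod>i<n. sqrt (real n) * real R / c i + 2)
        = (\<Prod>i<n. real R * (sqrt (real n) / c i + 2 / real R))"
      using R0 by (intro prod.cong) (auto simp: distrib_left)
    then show ?thesis using R R0 by (simp add: prod.distrib mult.assoc)
  qed
  define cube where "cube = PiE {..<n} (\<lambda>_. {0..<int R})"
  \<comment> \<open>The extreme values of the form \<open>e i\<close> on the cube with side
    \<open>R\<close>: every coordinate is 0 or \<open>R\<close>, according to the sign of its
    coefficient.\<close>
  define lo where "lo i = (\<Sum>k<n. real R * min (e i k) 0)" for i
  define hi where "hi i = (\<Sum>k<n. real R * max (e i k) 0)" for i
  define cell where "cell i = {\<lfloor>lo i / c i\<rfloor>..\<lfloor>hi i / c i\<rfloor>}" for i
  \<comment> \<open>A pigeonhole consists of a value of \<open>\<phi>\<close> and, for every form,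
    an interval of length \<open>c i\<close>. Two points in one pigeonhole therefore differ by less
    than \<open>c i\<close> under form \<open>i\<close>.\<close>
  define f where "f x = (\<phi> x, \<lambda>i\<in>{..<n}. \<lfloor>dot n (\<lambda>k. real_of_int (x k)) (e i) / c i\<rfloor>)" for x
  have bounds: "lo i \<le> dot n (\<lambda>k. real_of_int (x k)) (e i)"
      "dot n (\<lambda>k. real_of_int (x k)) (e i) \<le> hi i" if "x \<in> cube" for x i
  proof -
    have x: "0 \<le> real_of_int (x k)" "real_of_int (x k) \<le> real R" if "k < n" for k
    proof -
      have "x k \<in> {0..<int R}"
        using \<open>x \<in> cube\<close> that unfolding cube_def by (intro PiE_mem[of x "{..<n}"]) auto
      then show "0 \<le> real_of_int (x k)" "real_of_int (x k) \<le> real R" by auto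
    qed
    have ineq: "real R * min (e i k) 0 \<le> real_of_int (x k) * e i k \<and>
        real_of_int (x k) * e i k \<le> real R * max (e i k) 0" if "k < n" for k
    proof (cases "e i k \<ge> 0")
      case True
      then show ?thesis using x[OF that] by (simp add: mult_right_mono min_def max_def)
    next
      case False
      then show ?thesis
        using x[OF that] mult_nonneg_nonpos[of "real_of_int (x k)" "e i k"]
        by (simp add: mult_right_mono_neg min_def max_def)
    qed
    show "lo i \<le> dot n (\<lambda>k. real_of_int (x k)) (e i)"
      "dot n (\<lambda>k. real_of_int (x k)) (e i) \<le> hi i"
      using ineq by (auto simp: lo_def hi_def dot_def intro!: sum_mono)
  qed
  have f: "f ` cube \<subseteq> range \<phi> \<times> PiE {..<n} cell"
  proof (intro image_subsetI)
    fix x assume x: "x \<in> cube"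
    have "\<lfloor>dot n (\<lambda>k. real_of_int (x k)) (e i) / c i\<rfloor> \<in> cell i" if "i < n" for i
      using bounds[OF x, of i] c[OF that]
      by (auto simp: cell_def intro!: floor_mono divide_right_mono)
    then show "f x \<in> range \<phi> \<times> PiE {..<n} cell"
      by (auto simp: f_def restrict_PiE_iff)
  qed
  \<comment> \<open>Cauchy-Schwarz against the all-ones vector; this is the source of the factors
    \<open>sqrt (real n)\<close> in \<open>big\<close>.\<close>
  have width: "hi i - lo i \<le> sqrt (real n) * real R" if "i < n" for i
  proof -
    have "hi i - lo i = real R * (\<Sum>k<n. \<bar>e i k\<bar>)"
      by (auto simp: hi_def lo_def sum_subtractf[symmetric] sum_distrib_left right_diff_distrib[symmetric]
          intro!: sum.cong)
    moreover have "(\<Sum>k<n. \<bar>e i k\<bar> * \<bar>1\<bar>) \<le> L2_set (e i) {..<n} * L2_set (\<lambda>_. 1) {..<n}"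
      by (rule L2_set_mult_ineq)
    moreover have "L2_set (e i) {..<n} \<le> 1"
      using e[OF that] by (simp add: L2_set_def dot_def power2_eq_square)
    moreover have "L2_set (\<lambda>_. 1 :: real) {..<n} = sqrt (real n)"
      by (simp add: L2_set_def)
    ultimately have "(\<Sum>k<n. \<bar>e i k\<bar>) \<le> sqrt (real n)"
      using mult_right_mono[of "L2_set (e i) {..<n}" 1 "sqrt (real n)"] by simp
    then show ?thesis
      unfolding \<open>hi i - lo i = _\<close> mult.commute[of "sqrt (real n)"] by (rule mult_left_mono) simp
  qed
  have cell: "real (card (cell i)) \<le> sqrt (real n) * real R / c i + 2" if i: "i < n" for i
  proof -
    have "lo i \<le> hi i"
      by (auto simp: lo_def hi_def intro!: sum_mono mult_left_mono)
    then have "real (card (cell i)) \<le> (hi i - lo i) / c i + 2"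
      unfolding cell_def using c[OF i] by (rule card_floor_interval[rotated])
    also have "\<dots> \<le> sqrt (real n) * real R / c i + 2"
      using width[OF i] c[OF i] by (simp add: divide_right_mono)
    finally show ?thesis .
  qed
  have finP: "finite (range \<phi> \<times> PiE {..<n} cell)"
    using fin by (auto intro!: finite_PiE simp: cell_def)
  have "real (card (f ` cube)) \<le> real (card (range \<phi> \<times> PiE {..<n} cell))"
    using card_mono[OF finP f] by simp
  also have "\<dots> = ?I * (\<Prod>i<n. real (card (cell i)))"
    by (simp add: card_cartesian_product card_PiE)
  also have "\<dots> \<le> ?I * (\<Prod>i<n. sqrt (real n) * real R / c i + 2)"
    using cell by (intro mult_left_mono prod_mono) auto
  also have "\<dots> < real (card cube)"
    using R' by (simp add: cube_def card_PiE mult.commute)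
  finally have "\<not> inj_on f cube"
    by (intro pigeonhole) simp
  then obtain x y where xy: "x \<in> cube" "y \<in> cube" "x \<noteq> y" "f x = f y"
    by (auto simp: inj_on_def)
  show ?thesis
  proof (rule that)
    show "\<phi> x = \<phi> y" using xy by (simp add: f_def)
    show "\<exists>i<n. x i \<noteq> y i"
      using xy PiE_ext[of x "{..<n}" _ y] unfolding cube_def by blast
    fix i assume i: "i < n"
    let ?d = "\<lambda>x. dot n (\<lambda>k. real_of_int (x k)) (e i)"
    have "\<lfloor>?d x / c i\<rfloor> = \<lfloor>?d y / c i\<rfloor>"
      using xy i by (auto simp: f_def fun_eq_iff restrict_def split: if_splits)
    then have "\<bar>?d x / c i - ?d y / c i\<bar> < 1" by linarith
    moreover have "?d x / c i - ?d y / c i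
        = dot n (\<lambda>k. real_of_int (x k - y k)) (e i) / c i"
      by (simp add: dot_def left_diff_distrib sum_subtractf diff_divide_distrib)
    ultimately show "\<bar>dot n (\<lambda>k. real_of_int (x k - y k)) (e i)\<bar> < c i"
      using c[OF i] by (simp add: abs_divide)
  qed
qed

section \<open>Short independent lattice vectors\<close>

definition sqnorm :: "nat \<Rightarrow> (nat \<Rightarrow> int) \<Rightarrow> nat" where
  "sqnorm n x = nat (\<Sum>i<n. (x i)\<^sup>2)"

definition intnorm :: "nat \<Rightarrow> (nat \<Rightarrow> int) \<Rightarrow> real" where
  "intnorm n x = L2_set (\<lambda>i. real_of_int (x i)) {..<n}"

definition column_mat :: "nat \<Rightarrow> (nat \<Rightarrow> nat \<Rightarrow> 'a) \<Rightarrow> 'a mat" where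
  "column_mat n B = mat n n (\<lambda>(i, j). B j i)"

lemma column_mat_carrier [simp]: "column_mat n B \<in> carrier_mat n n"
  by (simp add: column_mat_def)

lemma sqnorm_dot: "real (sqnorm n x) = dot n (\<lambda>i. real_of_int (x i)) (\<lambda>i. real_of_int (x i))"
proof -
  have "real (sqnorm n x) = real_of_int (\<Sum>i<n. (x i)\<^sup>2)"
    by (simp add: sqnorm_def sum_nonneg)
  then show ?thesis by (simp add: dot_def power2_eq_square)
qed

lemma intnorm_sqnorm: "intnorm n x = sqrt (real (sqnorm n x))"
  by (simp add: sqnorm_dot intnorm_def L2_set_def dot_def power2_eq_square)

lemma det_column_mat_real:
  "det (column_mat n (\<lambda>j i. real_of_int (B j i))) = real_of_int (det (column_mat n B))"
proof -
  have "column_mat n (\<lambda>j i. real_of_int (B j i)) = map_mat real_of_int (column_mat n B)"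
    by (rule eq_matI) (auto simp: column_mat_def)
  then show ?thesis by simp
qed

lemma sqnorm_column_pos:
  assumes "det (column_mat n B) \<noteq> 0" "j < n"
  shows "sqnorm n (B j) > 0"
proof (rule ccontr)
  assume "\<not> sqnorm n (B j) > 0"
  then have z: "real_of_int (B j i) = 0" if "i < n" for i
    using that sqnorm_dot[of n "B j"] dot_self_zero_iff[of n "\<lambda>i. real_of_int (B j i)"] by auto
  have "det (column_mat n B) = 0"
    using z assms(2)
    by (subst laplace_expansion_column[OF column_mat_carrier, of j]) (auto simp: column_mat_def)
  then show False using assms by simp
qed

lemma det_column_mat_swap:
  assumes "i < n" "j < n" "i \<noteq> j"
  shows "det (column_mat n (B(i := B j, j := B i))) = - det (column_mat n B :: 'a :: comm_ring_1 mat)"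
proof -
  have "column_mat n (B(i := B j, j := B i)) = swapcols i j (column_mat n B)"
    using assms by (intro eq_matI) (auto simp: column_mat_def)
  then show ?thesis using assms det_swapcols[OF assms column_mat_carrier] by simp
qed

text \<open>The sum is weighted so that its minimiser is sorted by length; minimality also bounds
  every \<open>B i\<close> by any lattice vector that may replace it.\<close>

lemma minimal_lattice_columns:
  assumes B0: "\<forall>j<n. B0 j \<in> \<Lambda>" "det (column_mat n B0) \<noteq> 0"
  obtains B where "\<And>j. j < n \<Longrightarrow> B j \<in> \<Lambda>" "det (column_mat n B) \<noteq> 0"
    "\<And>i j. i \<le> j \<Longrightarrow> j < n \<Longrightarrow> sqnorm n (B i) \<le> sqnorm n (B j)"
    "\<And>i x. i < n \<Longrightarrow> x \<in> \<Lambda> \<Longrightarrow> det (column_mat n (B(i := x))) \<noteq> 0 \<Longrightarrow> sqnorm n (B i) \<le> sqnorm n x"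
proof -
  define P where "P B \<longleftrightarrow> (\<forall>j<n. B j \<in> \<Lambda>) \<and> det (column_mat n B) \<noteq> 0" for B
  \<comment> \<open>The weights are positive and strictly decreasing, so \<open>\<mu>\<close> drops
    when an unsorted pair is swapped or a vector is replaced by a shorter one. Squared lengths are
    natural numbers, hence a minimiser exists.\<close>
  define \<mu> where "\<mu> B = (\<Sum>j<n. (n - j) * sqnorm n (B j))" for B
  have "P B0" using B0 by (simp add: P_def)
  then obtain B where B: "P B" and least: "\<And>B'. P B' \<Longrightarrow> \<mu> B \<le> \<mu> B'"
    using ex_has_least_nat[of P B0 \<mu>] by blast
  have sorted: "sqnorm n (B i) \<le> sqnorm n (B j)" if ij: "i < j" "j < n" for i j
  proof -
    let ?B = "B(i := B j, j := B i)"
    have i: "i < n" using ij by simp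
    have "P ?B"
      using B ij det_column_mat_swap[of i n j B] by (auto simp: P_def)
    then have le: "\<mu> B \<le> \<mu> ?B" by (rule least)
    define S where "S = (\<Sum>l\<in>{..<n} - {i} - {j}. (n - l) * sqnorm n (B l))"
    have split: "(\<Sum>l<n. f l) = f i + (f j + (\<Sum>l\<in>{..<n} - {i} - {j}. f l))" for f :: "nat \<Rightarrow> nat"
      using ij i by (subst sum.remove[of _ i], simp, simp) (subst sum.remove[of _ j], auto)
    have "\<mu> B = (n - i) * sqnorm n (B i) + ((n - j) * sqnorm n (B j) + S)"
      unfolding \<mu>_def S_def by (rule split)
    moreover have "\<mu> ?B = (n - i) * sqnorm n (B j) + ((n - j) * sqnorm n (B i) + S)"
      unfolding \<mu>_def S_def split using ij by (auto intro!: sum.cong)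
    ultimately have "(n - i) * sqnorm n (B i) + (n - j) * sqnorm n (B j)
        \<le> (n - i) * sqnorm n (B j) + (n - j) * sqnorm n (B i)"
      using le by simp
    moreover have "n - i = (n - j) + (j - i)" using ij by simp
    ultimately have "(j - i) * sqnorm n (B i) \<le> (j - i) * sqnorm n (B j)"
      by (simp add: add_mult_distrib)
    then show ?thesis using ij by simp
  qed
  have exchange: "sqnorm n (B i) \<le> sqnorm n x"
    if i: "i < n" and x: "x \<in> \<Lambda>" "det (column_mat n (B(i := x))) \<noteq> 0" for i x
  proof -
    have "P (B(i := x))" using B x by (auto simp: P_def)
    then have "\<mu> B \<le> \<mu> (B(i := x))" by (rule least)
    moreover have "\<mu> B' = (n - i) * sqnorm n (B' i) + (\<Sum>l\<in>{..<n} - {i}. (n - l) * sqnorm n (B' l))" for B'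
      unfolding \<mu>_def using i by (intro sum.remove) auto
    ultimately have "(n - i) * sqnorm n (B i) \<le> (n - i) * sqnorm n x"
      by simp
    then show ?thesis using i by simp
  qed
  show ?thesis
    using that[of B] B sorted exchange unfolding P_def by (metis le_neq_implies_less order_refl)
qed

text \<open>On each coordinate axis infinitely many integer points share finitely many values of
  \<open>\<phi>\<close>, so the difference of two of them is a nonzero axis vector in
  \<open>\<Lambda>\<close>. These vectors form a diagonal matrix. The result is the starting point
  of the minimisation.\<close>

lemma lattice_columns_exist:
  fixes \<phi> :: "(nat \<Rightarrow> int) \<Rightarrow> 'c"
  assumes fin: "finite (range \<phi>)"
    and diff: "\<And>x y. \<phi> x = \<phi> y \<Longrightarrow> (\<lambda>i. x i - y i) \<in> \<Lambda>"
  obtains B where "\<forall>j<n. B j \<in> \<Lambda>" "det (column_mat n B) \<noteq> 0"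
proof -
  have "\<exists>N. N \<noteq> 0 \<and> (\<lambda>l. if l = i then N else 0) \<in> \<Lambda>" for i :: nat
  proof -
    let ?f = "\<lambda>a :: int. \<phi> (\<lambda>l. if l = i then a else 0)"
    have "finite (range ?f)" by (rule finite_subset[OF _ fin]) auto
    then have "\<not> inj ?f" using finite_imageD infinite_UNIV_int by blast
    then obtain a b where ab: "a \<noteq> b" "?f a = ?f b" by (auto simp: inj_def)
    have "(\<lambda>l. (if l = i then a else 0) - (if l = i then b else 0)) \<in> \<Lambda>"
      using ab(2) by (rule diff)
    moreover have "(\<lambda>l. (if l = i then a else 0) - (if l = i then b else 0))
        = (\<lambda>l. if l = i then a - b else 0)" by auto
    ultimately show ?thesis using ab(1) by (intro exI[of _ "a - b"]) auto
  qed
  then obtain N where N: "\<And>i. N i \<noteq> 0" "\<And>i. (\<lambda>l. if l = i then N i else 0) \<in> \<Lambda>"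
    by metis
  define B where "B i = (\<lambda>l. if l = i then N i else 0)" for i
  have "det (column_mat n B) = prod_list (diag_mat (column_mat n B))"
    by (rule det_upper_triangular[of _ n]) (auto simp: column_mat_def B_def)
  also have "\<dots> = (\<Prod>i = 0..<n. N i)"
    unfolding prod_list_diag_prod by (auto simp: column_mat_def B_def intro!: prod.cong)
  finally have "det (column_mat n B) \<noteq> 0" using N by simp
  then show ?thesis using that[of B] N by (auto simp: B_def)
qed

text \<open>Take the sorted minimal columns. If their lengths had too large a product, the
  pigeonhole lemma applied to the Gram-Schmidt vectors would give a nonzero lattice vector
  \<open>z\<close> that is small in every Gram-Schmidt direction. Then \<open>z\<close> is shorter
  than the last column occurring in its expansion and may replace it, against minimality.\<close>

lemma minkowski_second_weak:
  fixes \<phi> :: "(nat \<Rightarrow> int) \<Rightarrow> 'c"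
  assumes fin: "finite (range \<phi>)"
    and diff: "\<And>x y. \<phi> x = \<phi> y \<Longrightarrow> (\<lambda>i. x i - y i) \<in> \<Lambda>"
  obtains B where "\<And>j. j < n \<Longrightarrow> B j \<in> \<Lambda>" "det (column_mat n B) \<noteq> 0"
    "\<And>i j. i \<le> j \<Longrightarrow> j < n \<Longrightarrow> intnorm n (B i) \<le> intnorm n (B j)"
    "(\<Prod>j<n. intnorm n (B j)) \<le> real n ^ n * real (card (range \<phi>))"
proof -
  obtain B0 where "\<forall>j<n. B0 j \<in> \<Lambda>" "det (column_mat n B0) \<noteq> 0"
    using lattice_columns_exist[where \<Lambda> = \<Lambda> and n = n, OF fin diff] by metis
  then obtain B where B: "\<And>j. j < n \<Longrightarrow> B j \<in> \<Lambda>" and det: "det (column_mat n B) \<noteq> 0"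
    and sorted: "\<And>i j. i \<le> j \<Longrightarrow> j < n \<Longrightarrow> sqnorm n (B i) \<le> sqnorm n (B j)"
    and exchange: "\<And>i x. i < n \<Longrightarrow> x \<in> \<Lambda> \<Longrightarrow> det (column_mat n (B(i := x))) \<noteq> 0
        \<Longrightarrow> sqnorm n (B i) \<le> sqnorm n x"
    using minimal_lattice_columns[of n B0 \<Lambda>] by metis
  define b where "b j i = real_of_int (B j i)" for j i
  obtain e where e: "(\<forall>i<n. \<forall>j<n. i \<noteq> j \<longrightarrow> dot n (e i) (e j) = 0) \<and>
    (\<forall>i<n. dot n (e i) (e i) = 1 \<or> (\<forall>k. e i k = 0)) \<and>
    (\<forall>i<n. \<forall>k<n. b i k = (\<Sum>j\<le>i. dot n (b i) (e j) * e j k))"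
    using gram_schmidt_prefix[of n n b] ..
  have unit: "dot n (e i) (e i) \<le> 1" if "i < n" for i
  proof -
    have "dot n (e i) (e i) = 1 \<or> (\<forall>k. e i k = 0)" using e that by metis
    then show ?thesis by (auto simp: dot_def)
  qed
  \<comment> \<open>With this division at most \<open>n\<close> squares, each below
    \<open>|B i|^2 / n\<close>, add up to less than \<open>|B i|^2\<close>. Its cost
    \<open>sqrt n ^ n\<close> and the equal factor from the pigeonhole lemma make up
    \<open>n ^ n\<close>.\<close>
  define c where "c i = intnorm n (B i) / sqrt (real n)" for i
  have pos: "intnorm n (B i) > 0" if "i < n" for i
    using sqnorm_column_pos[OF det that] by (simp add: intnorm_sqnorm)
  have cpos: "c i > 0" if "i < n" for i
    using pos[OF that] that by (simp add: c_def)
  have "(\<Prod>j<n. intnorm n (B j)) \<le> real n ^ n * real (card (range \<phi>))"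
  proof (rule ccontr)
    assume "\<not> ?thesis"
    then have "real n ^ n * real (card (range \<phi>)) < (\<Prod>j<n. intnorm n (B j))" by simp
    moreover have "(\<Prod>j<n. intnorm n (B j)) = sqrt (real n) ^ n * (\<Prod>j<n. c j)"
    proof -
      have "(\<Prod>j<n. intnorm n (B j)) = (\<Prod>j<n. sqrt (real n) * c j)"
        by (intro prod.cong) (auto simp: c_def)
      then show ?thesis by (simp add: prod.distrib)
    qed
    moreover have "real n ^ n = sqrt (real n) ^ n * sqrt (real n) ^ n"
      by (simp add: power_mult_distrib[symmetric])
    ultimately have "sqrt (real n) ^ n * (sqrt (real n) ^ n * real (card (range \<phi>)))
        < sqrt (real n) ^ n * (\<Prod>j<n. c j)" by (simp add: mult.assoc)
    moreover have "sqrt (real n) ^ n \<ge> 0" by simp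
    ultimately have big: "sqrt (real n) ^ n * real (card (range \<phi>)) < (\<Prod>i<n. c i)"
      by (meson mult_less_cancel_left_disj not_less)
    obtain x y where xy: "\<phi> x = \<phi> y" "\<exists>i<n. x i \<noteq> y i"
      and small: "\<And>i. i < n \<Longrightarrow> \<bar>dot n (\<lambda>k. real_of_int (x k - y k)) (e i)\<bar> < c i"
      using minkowski_linear_forms[where e = e and c = c, OF fin unit cpos big] by blast
    define z where "z k = x k - y k" for k
    define zr where "zr k = real_of_int (z k)" for k
    have z: "z \<in> \<Lambda>" using diff[OF xy(1)] by (simp add: z_def[abs_def])
    define M where "M = column_mat n b"
    have M: "M \<in> carrier_mat n n" by (simp add: M_def)
    have detM: "det M \<noteq> 0"
      using det det_column_mat_real[of n B] by (simp add: M_def b_def[abs_def])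
    \<comment> \<open>The coordinates of \<open>z\<close> with respect to the columns of
      \<open>M\<close>, by the adjugate formula.\<close>
    define w where "w = (1 / det M) \<cdot>\<^sub>v (adj_mat M *\<^sub>v vec n zr)"
    have w: "w \<in> carrier_vec n" using adj_mat(1)[OF M] by (simp add: w_def)
    have Mw: "M *\<^sub>v w = vec n zr"
    proof -
      have "M *\<^sub>v w = (1 / det M) \<cdot>\<^sub>v (M *\<^sub>v (adj_mat M *\<^sub>v vec n zr))"
        unfolding w_def using adj_mat(1)[OF M] M by (intro mult_mat_vec) auto
      also have "M *\<^sub>v (adj_mat M *\<^sub>v vec n zr) = (M * adj_mat M) *\<^sub>v vec n zr"
        using adj_mat(1)[OF M] M by (intro assoc_mult_mat_vec[symmetric]) auto
      also have "\<dots> = det M \<cdot>\<^sub>v vec n zr"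
        unfolding adj_mat(2)[OF M] by (auto intro!: eq_vecI)
      finally show ?thesis using detM by (auto intro!: eq_vecI)
    qed
    have comb: "zr k = (\<Sum>j<n. w $ j * b j k)" if "k < n" for k
    proof -
      have "zr k = (M *\<^sub>v w) $ k" using Mw that by simp
      also have "\<dots> = (\<Sum>j<n. w $ j * b j k)"
        using w that by (simp add: M_def column_mat_def scalar_prod_def atLeast0LessThan mult.commute)
      finally show ?thesis .
    qed
    have "\<exists>j. j < n \<and> w $ j \<noteq> 0"
    proof (rule ccontr)
      assume "\<not> ?thesis"
      then have "zr k = 0" if "k < n" for k using comb[OF that] by simp
      then show False using xy(2) by (auto simp: zr_def z_def)
    qed
    \<comment> \<open>With \<open>i\<close> the last column occurring in \<open>z\<close>, only the
      directions \<open>e 0, ..., e i\<close> contribute to the length of \<open>z\<close>, and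
      sortedness bounds each contribution in terms of \<open>|B i|\<close>.\<close>
    then obtain i where i: "i < n" "w $ i \<noteq> 0" and max: "\<And>j. j < n \<Longrightarrow> w $ j \<noteq> 0 \<Longrightarrow> j \<le> i"
      using Nat.ex_has_greatest_nat[of "\<lambda>j. j < n \<and> w $ j \<noteq> 0" _ n] by (metis less_imp_le)
    have "zr k = (\<Sum>j\<le>i. w $ j * b j k)" if "k < n" for k
      unfolding comb[OF that]
    proof (rule sum.mono_neutral_right)
      show "\<forall>j\<in>{..<n} - {..i}. w $ j * b j k = 0"
      proof
        fix j assume "j \<in> {..<n} - {..i}"
        then have "w $ j = 0" using max[of j] by fastforce
        then show "w $ j * b j k = 0" by simp
      qed
    qed (use i in auto)
    then have "dot n zr zr = (\<Sum>l\<le>i. (dot n zr (e l))\<^sup>2)"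
      using e i by (intro gram_schmidt_parseval[of n n e b i zr "\<lambda>j. w $ j"]) auto
    also have "\<dots> < (\<Sum>l\<le>i. real (sqnorm n (B i)) / real n)"
    proof (rule sum_strict_mono)
      fix l assume "l \<in> {..i}"
      then have l: "l < n" "l \<le> i" using i by auto
      have "(dot n zr (e l))\<^sup>2 < (c l)\<^sup>2"
        using small[OF l(1)] cpos[OF l(1)] power2_strict_mono[of "dot n zr (e l)" "c l"]
        by (simp add: zr_def[abs_def] z_def)
      also have "\<dots> = real (sqnorm n (B l)) / real n"
        by (simp add: c_def intnorm_sqnorm power_divide)
      also have "\<dots> \<le> real (sqnorm n (B i)) / real n"
        using sorted[OF l(2) i(1)] by (simp add: divide_right_mono)
      finally show "(dot n zr (e l))\<^sup>2 < real (sqnorm n (B i)) / real n" .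
    qed auto
    also have "\<dots> = real (i + 1) / real n * real (sqnorm n (B i))" by simp
    also have "\<dots> \<le> 1 * real (sqnorm n (B i))"
      using i by (intro mult_right_mono) auto
    finally have "sqnorm n z < sqnorm n (B i)"
      using sqnorm_dot[of n z] by (simp add: zr_def[abs_def])
    moreover have "det (column_mat n (B(i := z))) \<noteq> 0"
    proof -
      \<comment> \<open>By Cramer's rule, putting \<open>z = M w\<close> in place of column
        \<open>i\<close> multiplies the determinant by \<open>w $ i\<close>, which is
        nonzero.\<close>
      have "column_mat n (\<lambda>j k. real_of_int ((B(i := z)) j k)) = replace_col M (M *\<^sub>v w) i"
        unfolding Mw using i
        by (intro eq_matI) (auto simp: column_mat_def M_def replace_col_def zr_def b_def)
      then have "real_of_int (det (column_mat n (B(i := z)))) = w $ i * det M"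
        using cramer_lemma_mat[OF M w i(1)] det_column_mat_real[of n "B(i := z)"] by simp
      then show ?thesis using i detM by auto
    qed
    ultimately show False using exchange[OF i(1) z] by simp
  qed
  then show ?thesis
    using that[of B] B det sorted by (simp add: intnorm_sqnorm)
qed

section \<open>A zero block bounds the nc-rank\<close>

definition nc_linear :: "nat \<Rightarrow> (nat \<Rightarrow> 'a :: field) \<Rightarrow> 'a nc_exp" where
  "nc_linear m c = nc_sum (\<lambda>k. NC_Mult (NC_Const (c k)) (NC_Var k)) m"

definition mat_linear :: "nat \<Rightarrow> nat \<Rightarrow> (nat \<Rightarrow> 'a :: field mat) \<Rightarrow> (nat \<Rightarrow> 'a) \<Rightarrow> 'a mat" where
  "mat_linear m d X c = mat d d (\<lambda>a. \<Sum>k<m. c k * X k $$ a)"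

lemma nc_vars_sum: "nc_vars (nc_sum e r) = (\<Union>k<r. nc_vars (e k))"
  by (induction r) (auto simp: less_Suc_eq)

lemma nc_vars_linear: "nc_vars (nc_linear m c) = {..<m}"
  by (auto simp: nc_linear_def nc_vars_sum)

lemma nc_eval_sum:
  assumes "\<And>k. k < r \<Longrightarrow> nc_eval d X (e k) = Some (M k)" "\<And>k. k < r \<Longrightarrow> M k \<in> carrier_mat d d"
  shows "nc_eval d X (nc_sum e r) = Some (mat d d (\<lambda>a. \<Sum>k<r. M k $$ a))"
  using assms
proof (induction r)
  case 0
  show ?case by (auto intro!: eq_matI)
next
  case (Suc r)
  have "mat d d (\<lambda>a. \<Sum>k<r. M k $$ a) + M r = mat d d (\<lambda>a. \<Sum>k<Suc r. M k $$ a)"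
    using Suc.prems(2)[of r] by (intro eq_matI) auto
  then show ?case using Suc by simp
qed

text \<open>Without inversions the evaluation never fails, and its value is determined by the
  coefficients. Equality of two elements of the free skew field thus follows from a comparison of
  coefficients.\<close>

lemma nc_eval_linear:
  assumes "X \<in> nc_points m d"
  shows "nc_eval d X (nc_linear m c) = Some (mat_linear m d X c)"
proof -
  have X: "X k \<in> carrier_mat d d" if "k < m" for k
    using assms that by (simp add: nc_points_def)
  have "(c k \<cdot>\<^sub>m 1\<^sub>m d) * X k = c k \<cdot>\<^sub>m X k" if "k < m" for k
    using X[OF that] by (simp add: mult_smult_assoc_mat[of _ d d _ d])
  then have "nc_eval d X (nc_linear m c) = Some (mat d d (\<lambda>a. \<Sum>k<m. (c k \<cdot>\<^sub>m X k) $$ a))"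
    unfolding nc_linear_def using X by (intro nc_eval_sum) auto
  also have "mat d d (\<lambda>a. \<Sum>k<m. (c k \<cdot>\<^sub>m X k) $$ a) = mat_linear m d X c"
    unfolding mat_linear_def
  proof (rule cong_mat)
    fix a b assume "a < d" "b < d"
    then have "(c k \<cdot>\<^sub>m X k) $$ (a, b) = c k * X k $$ (a, b)" if "k < m" for k
      using X[OF that] by simp
    then show "(\<Sum>k<m. (c k \<cdot>\<^sub>m X k) $$ (a, b)) = (\<Sum>k<m. c k * X k $$ (a, b))"
      by simp
  qed simp_all
  finally show ?thesis .
qed

lemma mat_linear_smult: "b \<cdot>\<^sub>m mat_linear m d X c = mat_linear m d X (\<lambda>k. b * c k)"
  unfolding mat_linear_def by (rule eq_matI) (auto simp: sum_distrib_left mult.assoc)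

lemma mat_linear_carrier [simp]: "mat_linear m d X c \<in> carrier_mat d d"
  by (simp add: mat_linear_def)

lemma nc_eval_const_linear:
  assumes "X \<in> nc_points m d"
  shows "nc_eval d X (NC_Mult (NC_Const b) (nc_linear m c)) = Some (mat_linear m d X (\<lambda>k. b * c k))"
  using nc_eval_linear[OF assms, of c] mat_linear_smult[of b m d X c]
  by (simp add: mult_smult_assoc_mat[of _ d d _ d] left_mult_one_mat[OF mat_linear_carrier])

lemma nc_eval_linear_const:
  assumes "X \<in> nc_points m d"
  shows "nc_eval d X (NC_Mult (nc_linear m c) (NC_Const b)) = Some (mat_linear m d X (\<lambda>k. b * c k))"
  using nc_eval_linear[OF assms, of c] mat_linear_smult[of b m d X c]
  by (simp add: mult_smult_distrib[of _ d d _ d] right_mult_one_mat[OF mat_linear_carrier])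

lemma nc_rationalI:
  assumes "nc_vars e \<subseteq> {..<m}" "\<And>d X. X \<in> nc_points m d \<Longrightarrow> nc_eval d X e \<noteq> None"
  shows "e \<in> nc_rational m"
proof -
  \<comment> \<open>The zero tuple of size 1 serves as the point of definition that
    \<open>nc_rational\<close> asks for.\<close>
  have "(\<lambda>_. 0\<^sub>m 1 1) \<in> nc_points m 1" by (simp add: nc_points_def)
  then have "\<exists>d>0. \<exists>X \<in> nc_points m d. nc_eval d X e \<noteq> None"
    using assms(2) by (intro exI[of _ 1] conjI bexI) simp_all
  then show ?thesis
    using assms(1) by (simp add: nc_rational_def)
qed

lemma sum_lessThan_add:
  fixes f :: "nat \<Rightarrow> 'a :: comm_monoid_add"
  shows "(\<Sum>l<a + b. f l) = (\<Sum>l<a. f l) + (\<Sum>l<b. f (a + l))"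
  by (induction b) (auto simp: add.assoc)

text \<open>\<open>B\<close> is factored through dimension \<open>(n - s) + (n - r) = n - 1\<close>: the last \<open>n - s\<close> columns of
  \<open>Y B X\<close> and, in the first \<open>s\<close> columns, its last \<open>n - r\<close> rows.\<close>

lemma nc_rank_less_if_zero_block:
  fixes B :: "nat \<Rightarrow> 'a :: field mat"
  assumes B: "\<And>k. k < m \<Longrightarrow> B k \<in> carrier_mat n n"
    and carr: "Y \<in> carrier_mat n n" "X \<in> carrier_mat n n" "Y' \<in> carrier_mat n n" "X' \<in> carrier_mat n n"
    and inv: "Y' * Y = 1\<^sub>m n" "X * X' = 1\<^sub>m n"
    and rs: "r \<le> n" "s \<le> n" "r + s = n + 1"
    and zero: "\<And>k i j. k < m \<Longrightarrow> i < r \<Longrightarrow> j < s \<Longrightarrow> (Y * B k * X) $$ (i, j) = 0"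
  shows "nc_rank n m B < n"
proof -
  define M where "M k = Y * B k * X" for k
  define \<alpha> where "\<alpha> i l k = (B k * X) $$ (i, s + l)" for i l k
  define \<gamma> where "\<gamma> l j k = (\<Sum>t<s. M k $$ (r + l, t) * X' $$ (t, j))" for l j k
  \<comment> \<open>Indices \<open>l < n - s\<close> pair the last columns of \<open>B X\<close>
    with the last rows of \<open>X'\<close>; the remaining ones pair the last columns of
    \<open>Y'\<close> with the rows \<open>\<gamma>\<close>. In every product one factor is constant
    and the other is a linear form.\<close>
  define V where "V i l = (if l < n - s then nc_linear m (\<alpha> i l) else NC_Const (Y' $$ (i, r + (l - (n - s)))))" for i l
  define W where "W l j = (if l < n - s then NC_Const (X' $$ (s + l, j)) else nc_linear m (\<gamma> (l - (n - s)) j))" for l j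
  define q where "q i j l k = (if l < n - s then X' $$ (s + l, j) * \<alpha> i l k
      else Y' $$ (i, r + (l - (n - s))) * \<gamma> (l - (n - s)) j k)" for i j l k
  have coeff: "B k $$ (i, j) = (\<Sum>l<n - 1. q i j l k)" if k: "k < m" and ij: "i < n" "j < n" for i j k
  proof -
    note Bk = B[OF k]
    have BX: "B k * X \<in> carrier_mat n n" and M: "M k \<in> carrier_mat n n"
      using Bk carr by (auto simp: M_def)
    \<comment> \<open>In the first \<open>s\<close> columns the first \<open>r\<close> rows of
      \<open>M k\<close> vanish, so only the last \<open>n - r\<close> columns of \<open>Y'\<close>
      contribute to \<open>B X = Y' M\<close>.\<close>
    have low: "(B k * X) $$ (i, t) = (\<Sum>l<n - r. Y' $$ (i, r + l) * M k $$ (r + l, t))" if t: "t < s" for t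
    proof -
      have "Y' * M k = (Y' * Y) * (B k * X)"
        unfolding M_def assoc_mult_mat[OF carr(1) Bk carr(2)] assoc_mult_mat[OF carr(3,1) BX] ..
      then have "(B k * X) $$ (i, t) = (Y' * M k) $$ (i, t)"
        by (simp only: inv(1) left_mult_one_mat[OF BX])
      also have "\<dots> = (\<Sum>u<r + (n - r). Y' $$ (i, u) * M k $$ (u, t))"
        using mat_mult_index_sum[OF carr(3) M] ij t rs by simp
      also have "\<dots> = (\<Sum>l<n - r. Y' $$ (i, r + l) * M k $$ (r + l, t))"
        unfolding sum_lessThan_add using zero[OF k _ t] by (simp add: M_def)
      finally show ?thesis .
    qed
    have "B k = B k * X * X'"
      unfolding assoc_mult_mat[OF Bk carr(2,4)] inv(2) using Bk by simp
    then have "B k $$ (i, j) = (B k * X * X') $$ (i, j)" by simp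
    also have "\<dots> = (\<Sum>t<s + (n - s). (B k * X) $$ (i, t) * X' $$ (t, j))"
      using mat_mult_index_sum[OF BX carr(4)] ij rs by simp
    also have "\<dots> = (\<Sum>l<n - s. X' $$ (s + l, j) * \<alpha> i l k) + (\<Sum>t<s. (B k * X) $$ (i, t) * X' $$ (t, j))"
      unfolding sum_lessThan_add by (simp add: \<alpha>_def mult.commute add.commute)
    also have "(\<Sum>t<s. (B k * X) $$ (i, t) * X' $$ (t, j))
        = (\<Sum>t<s. \<Sum>l<n - r. Y' $$ (i, r + l) * (M k $$ (r + l, t) * X' $$ (t, j)))"
      using low by (simp add: sum_distrib_right mult.assoc)
    also have "\<dots> = (\<Sum>l<n - r. Y' $$ (i, r + l) * \<gamma> l j k)"
      by (subst sum.swap) (simp add: \<gamma>_def sum_distrib_left)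
    also have "(\<Sum>l<n - s. X' $$ (s + l, j) * \<alpha> i l k) + \<dots> = (\<Sum>l<(n - s) + (n - r). q i j l k)"
      unfolding sum_lessThan_add by (simp add: q_def)
    also have "(n - s) + (n - r) = n - 1" using rs by simp
    finally show ?thesis .
  qed
  have prod: "nc_eval d Z (NC_Mult (V i l) (W l j)) = Some (mat_linear m d Z (q i j l))"
    if "Z \<in> nc_points m d" for d Z i j l
    using nc_eval_linear_const[OF that] nc_eval_const_linear[OF that]
    by (cases "l < n - s") (simp_all add: V_def W_def q_def[abs_def])
  have rat: "V i l \<in> nc_rational m" "W l j \<in> nc_rational m" for i j l
    by (auto simp: V_def W_def nc_vars_linear nc_eval_linear intro!: nc_rationalI)
  have "nc_equal m (pencil_entry m B i j) (nc_sum (\<lambda>l. NC_Mult (V i l) (W l j)) (n - 1))"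
    if ij: "i < n" "j < n" for i j
  proof -
    have left: "nc_eval d Z (pencil_entry m B i j) = Some (mat_linear m d Z (\<lambda>k. B k $$ (i, j)))"
      if "Z \<in> nc_points m d" for d Z
      using nc_eval_linear[OF that, of "\<lambda>k. B k $$ (i, j)"] by (simp add: pencil_entry_def nc_linear_def)
    have right: "nc_eval d Z (nc_sum (\<lambda>l. NC_Mult (V i l) (W l j)) (n - 1))
        = Some (mat_linear m d Z (\<lambda>k. B k $$ (i, j)))" if Z: "Z \<in> nc_points m d" for d Z
    proof -
      have "nc_eval d Z (nc_sum (\<lambda>l. NC_Mult (V i l) (W l j)) (n - 1))
          = Some (mat d d (\<lambda>a. \<Sum>l<n - 1. mat_linear m d Z (q i j l) $$ a))"
        using prod[OF Z] by (intro nc_eval_sum) auto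
      also have "mat d d (\<lambda>a. \<Sum>l<n - 1. mat_linear m d Z (q i j l) $$ a)
          = mat_linear m d Z (\<lambda>k. B k $$ (i, j))"
      proof (rule eq_matI)
        fix a b assume "a < dim_row (mat_linear m d Z (\<lambda>k. B k $$ (i, j)))"
          "b < dim_col (mat_linear m d Z (\<lambda>k. B k $$ (i, j)))"
        then have ab: "a < d" "b < d" by (auto simp: mat_linear_def)
        have "(\<Sum>l<n - 1. \<Sum>k<m. q i j l k * Z k $$ (a, b)) = (\<Sum>k<m. B k $$ (i, j) * Z k $$ (a, b))"
          using coeff ij by (subst sum.swap) (simp add: sum_distrib_right)
        then show "mat d d (\<lambda>a. \<Sum>l<n - 1. mat_linear m d Z (q i j l) $$ a) $$ (a, b)
            = mat_linear m d Z (\<lambda>k. B k $$ (i, j)) $$ (a, b)"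
          using ab by (simp add: mat_linear_def)
      qed (auto simp: mat_linear_def)
      finally show ?thesis .
    qed
    have "pencil_entry m B i j \<in> nc_rational m"
      using left nc_vars_linear[of m "\<lambda>k. B k $$ (i, j)"]
      by (intro nc_rationalI) (auto simp: pencil_entry_def nc_linear_def)
    moreover have "nc_sum (\<lambda>l. NC_Mult (V i l) (W l j)) (n - 1) \<in> nc_rational m"
      using right by (intro nc_rationalI) (auto simp: nc_vars_sum V_def W_def nc_vars_linear split: if_splits)
    ultimately show ?thesis
      unfolding nc_equal_def using left right by metis
  qed
  then have "nc_rank n m B \<le> n - 1"
    unfolding nc_rank_def using rat by (intro Least_le exI[of _ V] exI[of _ W]) auto
  then show ?thesis using rs by simp
qed

section \<open>The bound on MVMP\<close>

lemma GL_det_nonzero: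
  assumes "P \<in> GL n"
  shows "P \<in> carrier_mat n n" "det P \<noteq> 0"
proof -
  show P: "P \<in> carrier_mat n n" using assms by (simp add: GL_def)
  obtain R where R: "P * R = 1\<^sub>m (dim_row P)" "R * P = 1\<^sub>m (dim_row R)"
    using assms by (auto simp: GL_def invertible_mat_def inverts_mat_def)
  have "dim_col R = n" using R(1) P by (metis carrier_matD(1) index_mult_mat(3) index_one_mat(3))
  moreover have "dim_row R = n" using R(2) P by (metis carrier_matD(2) index_mult_mat(3) index_one_mat(3))
  ultimately have "R \<in> carrier_mat n n" by auto
  then have "det P * det R = det (1\<^sub>m n :: 'a mat)"
    using R(1) P det_mult[of P n R] by auto
  then show "det P \<noteq> 0" by auto
qed

lemma det_nonzero_inverse:
  fixes M :: "'a :: field mat"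
  assumes "M \<in> carrier_mat n n" "det M \<noteq> 0"
  obtains M' where "M' \<in> carrier_mat n n" "M * M' = 1\<^sub>m n" "M' * M = 1\<^sub>m n"
proof (rule that)
  note adj = adj_mat[OF assms(1)]
  let ?R = "(1 / det M) \<cdot>\<^sub>m adj_mat M"
  show "?R \<in> carrier_mat n n" using adj(1) by simp
  have "(1 / det M) \<cdot>\<^sub>m (det M \<cdot>\<^sub>m 1\<^sub>m n) = (1\<^sub>m n :: 'a mat)"
    using assms(2) by (intro eq_matI) auto
  then show "M * ?R = 1\<^sub>m n" "?R * M = 1\<^sub>m n"
    using adj assms(1) by (simp_all add: mult_smult_distrib[of _ n n _ n] mult_smult_assoc_mat[of _ n n _ n])
qed

section \<open>Bilinear forms on the two lattices: size against divisibility\<close>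

lemma sum_mat_mult_vec:
  fixes M N :: "'a :: comm_semiring_0 mat"
  assumes "M \<in> carrier_mat n n" "N \<in> carrier_mat n n" "l < n"
  shows "(\<Sum>i<n. M $$ (l, i) * (\<Sum>j<n. N $$ (i, j) * x j)) = (\<Sum>j<n. (M * N) $$ (l, j) * x j)"
proof -
  have "(\<Sum>i<n. M $$ (l, i) * (\<Sum>j<n. N $$ (i, j) * x j))
      = (\<Sum>i<n. \<Sum>j<n. M $$ (l, i) * N $$ (i, j) * x j)"
    by (simp add: sum_distrib_left mult.assoc)
  also have "\<dots> = (\<Sum>j<n. (M * N) $$ (l, j) * x j)"
    using assms mat_mult_index_sum[OF assms(1,2)]
    by (subst sum.swap) (simp add: sum_distrib_right)
  finally show ?thesis .
qed

lemma abs_sum_le_intnorm: "(\<Sum>i<n. \<bar>real_of_int (x i)\<bar>) \<le> sqrt (real n) * intnorm n x"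
proof -
  have "(\<Sum>i<n. \<bar>real_of_int (x i)\<bar> * \<bar>1\<bar>) \<le> intnorm n x * L2_set (\<lambda>_. 1) {..<n}"
    unfolding intnorm_def by (rule L2_set_mult_ineq)
  moreover have "L2_set (\<lambda>_. 1 :: real) {..<n} = sqrt (real n)"
    by (simp add: L2_set_def)
  ultimately show ?thesis by (simp add: mult.commute)
qed

definition int_bilinear :: "nat \<Rightarrow> int mat \<Rightarrow> (nat \<Rightarrow> int) \<Rightarrow> (nat \<Rightarrow> int) \<Rightarrow> int" where
  "int_bilinear n M y x = (\<Sum>i<n. y i * (\<Sum>j<n. M $$ (i, j) * x j))"

text \<open>The factor \<open>n\<close> is \<open>sqrt n\<close> twice: once for each vector, when
  Cauchy-Schwarz replaces the sum of absolute values by the Euclidean length.\<close>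

lemma int_bilinear_bound:
  assumes "\<And>i j. i < n \<Longrightarrow> j < n \<Longrightarrow> \<bar>real_of_int (M $$ (i, j))\<bar> \<le> D" "D \<ge> 0"
  shows "\<bar>real_of_int (int_bilinear n M y x)\<bar> \<le> real n * D * intnorm n x * intnorm n y"
proof -
  let ?a = "\<lambda>x i. \<bar>real_of_int (x i)\<bar>"
  have "\<bar>real_of_int (int_bilinear n M y x)\<bar>
      = \<bar>\<Sum>i<n. real_of_int (y i) * (\<Sum>j<n. real_of_int (M $$ (i, j)) * real_of_int (x j))\<bar>"
    by (simp add: int_bilinear_def)
  also have "\<dots> \<le> (\<Sum>i<n. ?a y i * (\<Sum>j<n. D * ?a x j))"
  proof (rule order_trans[OF sum_abs], rule sum_mono)
    fix i assume "i \<in> {..<n}"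
    then have "\<bar>\<Sum>j<n. real_of_int (M $$ (i, j)) * real_of_int (x j)\<bar> \<le> (\<Sum>j<n. D * ?a x j)"
      using assms(1) by (intro order_trans[OF sum_abs] sum_mono) (auto simp: abs_mult intro!: mult_right_mono)
    then show "\<bar>real_of_int (y i) * (\<Sum>j<n. real_of_int (M $$ (i, j)) * real_of_int (x j))\<bar>
        \<le> ?a y i * (\<Sum>j<n. D * ?a x j)"
      by (simp add: abs_mult mult_left_mono)
  qed
  also have "\<dots> = D * ((\<Sum>i<n. ?a y i) * (\<Sum>j<n. ?a x j))"
    by (simp add: sum_distrib_left[symmetric] sum_distrib_right[symmetric] mult_ac)
  also have "\<dots> \<le> D * ((sqrt (real n) * intnorm n y) * (sqrt (real n) * intnorm n x))"
    using assms(2) by (intro mult_left_mono mult_mono abs_sum_le_intnorm)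
      (auto intro!: sum_nonneg mult_nonneg_nonneg simp: intnorm_def)
  also have "\<dots> = D * (sqrt (real n) * sqrt (real n)) * intnorm n x * intnorm n y"
    by (simp only: mult_ac)
  finally show ?thesis by (simp add: mult_ac)
qed

context
  fixes p :: nat
  assumes prime: "prime p"
begin

lemma Zloc_scale:
  obtains a where "\<And>i j. i < n \<Longrightarrow> j < n \<Longrightarrow> of_nat p ^ a * M $$ (i, j) \<in> Zloc p"
proof -
  have "\<exists>a. of_nat p ^ a * x \<in> Zloc p" for x
  proof (cases "x = 0")
    case False
    then obtain k where k: "vp p x = ereal (real_of_int k)"
      using vp_finite[OF prime] by blast
    have "of_nat p ^ nat (- k) * x \<in> Zloc p"
      by (simp add: Zloc_def vp_mult[OF prime] vp_power_p[OF prime] k)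
    then show ?thesis ..
  qed (use Zloc_0[OF prime] in simp)
  then obtain f where f: "\<And>x. of_nat p ^ f x * x \<in> Zloc p" by metis
  \<comment> \<open>The sum of the exponents sufficient for the single entries dominates each of
    them.\<close>
  define a where "a = (\<Sum>ij\<in>{..<n} \<times> {..<n}. f (M $$ ij))"
  have "of_nat p ^ a * M $$ (i, j) \<in> Zloc p" if "i < n" "j < n" for i j
  proof -
    have "f (M $$ (i, j)) \<le> a"
      unfolding a_def using that
      by (intro member_le_sum[where f = "\<lambda>ij. f (M $$ ij)"]) auto
    then have "of_nat p ^ a * M $$ (i, j)
        = of_int (int p ^ (a - f (M $$ (i, j)))) * (of_nat p ^ f (M $$ (i, j)) * M $$ (i, j))"
      by (simp add: power_add[symmetric] mult.assoc[symmetric])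
    then show ?thesis using f Zloc_mult[OF prime] Zloc_of_int[OF prime] by metis
  qed
  then show ?thesis by (rule that)
qed

text \<open>Scaling by \<open>p ^ a\<close> makes \<open>Q\<close> integral, so that the index bound
  and the Minkowski bound apply; it shifts the valuation of the determinant by \<open>a * n\<close>.
  The integral coordinates \<open>z\<close> with respect to \<open>Q\<close> are kept for the
  divisibility argument.\<close>

lemma reduced_lattice_columns:
  assumes Q: "Q \<in> carrier_mat n n" "det Q \<noteq> 0"
    and int: "\<And>i j. i < n \<Longrightarrow> j < n \<Longrightarrow> of_nat p ^ a * Q $$ (i, j) \<in> Zloc p"
  obtains B :: "nat \<Rightarrow> nat \<Rightarrow> int" and V :: nat where
    "\<And>j. j < n \<Longrightarrow> \<exists>z. (\<forall>t<n. z t \<in> Zloc p) \<and>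
        (\<forall>i<n. of_int (B j i) = of_nat p ^ a * (\<Sum>t<n. Q $$ (i, t) * z t))"
    "det (column_mat n B) \<noteq> 0"
    "\<And>i j. i \<le> j \<Longrightarrow> j < n \<Longrightarrow> intnorm n (B i) \<le> intnorm n (B j)"
    "(\<Prod>j<n. intnorm n (B j)) \<le> real n ^ n * real p ^ V"
    "ereal (real V) \<le> vp p (det Q) + ereal (real (a * n))"
proof -
  let ?Q = "of_nat p ^ a \<cdot>\<^sub>m Q"
  have p0: "(of_nat p :: rat) \<noteq> 0" using prime prime_gt_0_nat by auto
  have det: "det ?Q = of_nat p ^ (a * n) * det Q"
    using Q(1) by (simp add: power_mult)
  obtain \<phi> :: "(nat \<Rightarrow> int) \<Rightarrow> (nat \<Rightarrow> int)" and V :: nat where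
    \<phi>: "finite (range \<phi>)" "card (range \<phi>) \<le> p ^ V" "ereal (real V) \<le> vp p (det ?Q)"
    "\<And>x y. \<phi> x = \<phi> y \<Longrightarrow> (\<lambda>i. of_int (x i - y i)) \<in> zlattice p n ?Q"
    using zlattice_index[OF prime, of ?Q n] Q int det p0 by auto
  define \<Lambda> where "\<Lambda> = {x. (\<lambda>i. of_int (x i)) \<in> zlattice p n ?Q}"
  obtain B where B: "\<And>j. j < n \<Longrightarrow> B j \<in> \<Lambda>" "det (column_mat n B) \<noteq> 0"
    "\<And>i j. i \<le> j \<Longrightarrow> j < n \<Longrightarrow> intnorm n (B i) \<le> intnorm n (B j)"
    "(\<Prod>j<n. intnorm n (B j)) \<le> real n ^ n * real (card (range \<phi>))"
    using minkowski_second_weak[of \<phi> \<Lambda> n] \<phi>(1,4) unfolding \<Lambda>_def by blast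
  show ?thesis
  proof (rule that[of B V])
    fix j assume "j < n"
    then have "(\<lambda>i. of_int (B j i)) \<in> zlattice p n ?Q" using B(1) by (simp add: \<Lambda>_def)
    then obtain z where z: "\<forall>t<n. z t \<in> Zloc p" "\<forall>i<n. of_int (B j i) = (\<Sum>t<n. ?Q $$ (i, t) * z t)"
      by (auto simp: zlattice_def)
    have "(\<Sum>t<n. ?Q $$ (i, t) * z t) = of_nat p ^ a * (\<Sum>t<n. Q $$ (i, t) * z t)" if "i < n" for i
      using Q(1) that by (simp add: sum_distrib_left mult.assoc)
    then show "\<exists>z. (\<forall>t<n. z t \<in> Zloc p) \<and>
        (\<forall>i<n. of_int (B j i) = of_nat p ^ a * (\<Sum>t<n. Q $$ (i, t) * z t))"
      using z by auto
  next
    have "real (card (range \<phi>)) \<le> real p ^ V" using \<phi>(2) by (metis of_nat_le_iff of_nat_power)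
    then have "real n ^ n * real (card (range \<phi>)) \<le> real n ^ n * real p ^ V"
      by (intro mult_left_mono) auto
    then show "(\<Prod>j<n. intnorm n (B j)) \<le> real n ^ n * real p ^ V" using B(4) by linarith
  next
    show "ereal (real V) \<le> vp p (det Q) + ereal (real (a * n))"
      using \<phi>(3) unfolding det vp_mult[OF prime] vp_power_p[OF prime] by (simp add: add.commute)
  qed (use B in auto)
qed

text \<open>Substituting \<open>x = p^a Q z\<close> and \<open>y = p^b P^T w\<close> turns the form
  \<open>y^T M x\<close> into \<open>p^(a+b) w^T (P M Q) z\<close>, where the last factor is
  \<open>p\<close>-integral.\<close>

lemma int_bilinear_dvd:
  fixes x y :: "nat \<Rightarrow> int"
  assumes carr: "P \<in> carrier_mat n n" "M \<in> carrier_mat n n" "Q \<in> carrier_mat n n"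
    and int: "\<And>i j. i < n \<Longrightarrow> j < n \<Longrightarrow> (P * map_mat of_int M * Q) $$ (i, j) \<in> Zloc p"
    and z: "\<forall>t<n. z t \<in> Zloc p" "\<forall>j<n. of_int (x j) = of_nat p ^ a * (\<Sum>t<n. Q $$ (j, t) * z t)"
    and w: "\<forall>t<n. w t \<in> Zloc p" "\<forall>i<n. of_int (y i) = of_nat p ^ b * (\<Sum>t<n. P\<^sup>T $$ (i, t) * w t)"
  shows "int p ^ (a + b) dvd int_bilinear n M y x"
proof -
  let ?M = "map_mat of_int M :: rat mat"
  let ?s = "\<Sum>i<n. (\<Sum>t<n. P\<^sup>T $$ (i, t) * w t) * (\<Sum>j<n. ?M $$ (i, j) * (\<Sum>t<n. Q $$ (j, t) * z t))"
  have PM: "P * ?M \<in> carrier_mat n n" using carr by simp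
  have "of_int (int_bilinear n M y x) = (\<Sum>i<n. of_int (y i) * (\<Sum>j<n. ?M $$ (i, j) * of_int (x j)) :: rat)"
    using carr by (simp add: int_bilinear_def)
  also have "\<dots> = (\<Sum>i<n. of_nat p ^ (a + b) * ((\<Sum>t<n. P\<^sup>T $$ (i, t) * w t)
      * (\<Sum>j<n. ?M $$ (i, j) * (\<Sum>t<n. Q $$ (j, t) * z t))))"
  proof (rule sum.cong[OF refl])
    fix i assume "i \<in> {..<n}"
    have "(\<Sum>j<n. ?M $$ (i, j) * of_int (x j))
        = of_nat p ^ a * (\<Sum>j<n. ?M $$ (i, j) * (\<Sum>t<n. Q $$ (j, t) * z t))"
      using z(2) by (simp add: sum_distrib_left mult.left_commute del: index_map_mat)
    then show "of_int (y i) * (\<Sum>j<n. ?M $$ (i, j) * of_int (x j)) = of_nat p ^ (a + b) *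
        ((\<Sum>t<n. P\<^sup>T $$ (i, t) * w t) * (\<Sum>j<n. ?M $$ (i, j) * (\<Sum>t<n. Q $$ (j, t) * z t)))"
      using w(2) \<open>i \<in> {..<n}\<close> by (simp only: power_add lessThan_iff mult_ac)
  qed
  also have "\<dots> = of_nat p ^ (a + b) * ?s"
    by (simp only: sum_distrib_left)
  also have "?s = (\<Sum>i<n. \<Sum>l<n. w l * (P $$ (l, i) * (\<Sum>j<n. ?M $$ (i, j) * (\<Sum>t<n. Q $$ (j, t) * z t))))"
    using carr by (simp add: sum_distrib_right mult_ac)
  also have "\<dots> = (\<Sum>l<n. w l * (\<Sum>i<n. P $$ (l, i) * (\<Sum>j<n. ?M $$ (i, j) * (\<Sum>t<n. Q $$ (j, t) * z t))))"
    by (subst sum.swap) (simp only: sum_distrib_left)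
  also have "\<dots> = (\<Sum>l<n. w l * (\<Sum>t<n. (P * ?M * Q) $$ (l, t) * z t))"
  proof (rule sum.cong[OF refl])
    fix l assume "l \<in> {..<n}"
    then have l: "l < n" by simp
    have M: "?M \<in> carrier_mat n n" using carr by simp
    show "w l * (\<Sum>i<n. P $$ (l, i) * (\<Sum>j<n. ?M $$ (i, j) * (\<Sum>t<n. Q $$ (j, t) * z t)))
        = w l * (\<Sum>t<n. (P * ?M * Q) $$ (l, t) * z t)"
      unfolding sum_mat_mult_vec[OF carr(1) M l] sum_mat_mult_vec[OF PM carr(3) l] ..
  qed
  finally have eq: "of_int (int_bilinear n M y x)
      = of_nat p ^ (a + b) * (\<Sum>l<n. w l * (\<Sum>t<n. (P * ?M * Q) $$ (l, t) * z t))" .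
  have "(\<Sum>l<n. w l * (\<Sum>t<n. (P * ?M * Q) $$ (l, t) * z t)) \<in> Zloc p"
    using z(1) w(1) int by (intro Zloc_sum[OF prime] Zloc_mult[OF prime]) auto
  then have "ereal (real (a + b)) + 0 \<le> vp p (of_int (int_bilinear n M y x))"
    unfolding eq vp_mult[OF prime] vp_power_p[OF prime] Zloc_def by (intro add_left_mono) simp
  then show ?thesis by (simp only: add_0_right vp_of_int_ge_iff[OF prime])
qed

text \<open>If every \<open>i\<close> failed, multiply the \<open>n\<close> reverse inequalities:
  each \<open>B i\<close> and each \<open>C i\<close> occurs exactly once. The constant 3 counts the
  factor \<open>(n D)^n\<close> from the form and the two factors \<open>n^n\<close> from Minkowski,
  each at most \<open>(n D)^n\<close>. Taking logarithms contradicts \<open>big\<close>.\<close>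

lemma block_norm_exists:
  fixes B C :: "nat \<Rightarrow> real"
  assumes n: "n > 0" and D: "D \<ge> 1"
    and nonneg: "\<And>i. B i \<ge> 0" "\<And>i. C i \<ge> 0"
    and B: "(\<Prod>j<n. B j) \<le> real n ^ n * real p ^ V" and C: "(\<Prod>j<n. C j) \<le> real n ^ n * real p ^ W"
    and big: "3 * real n * log (real p) (real n * D) + real V + real W < real (e * n)"
  shows "\<exists>i<n. real n * D * B i * C (n - Suc i) < real p ^ e"
proof (rule ccontr)
  assume none: "\<not> ?thesis"
  have le: "real p ^ e \<le> real n * D * B i * C (n - Suc i)" if "i < n" for i
    using none that by force
  have p1: "real p > 1" using prime_gt_1_nat[OF prime] by simp
  have nD: "real n * D > 0" using n D by simp
  have "real p ^ (e * n) = (\<Prod>i<n. real p ^ e)" by (simp add: power_mult)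
  also have "\<dots> \<le> (\<Prod>i<n. (real n * D) * B i * C (n - Suc i))"
    using le by (intro prod_mono) auto
  also have "\<dots> = (real n * D) ^ n * (\<Prod>i<n. B i) * (\<Prod>i<n. C i)"
    using prod.nat_diff_reindex[of C n] by (simp add: prod.distrib)
  also have "\<dots> \<le> (real n * D) ^ n * (real n ^ n * real p ^ V) * (real n ^ n * real p ^ W)"
    using B C nonneg nD by (intro mult_mono mult_left_mono) (auto intro!: prod_nonneg mult_nonneg_nonneg)
  also have "\<dots> \<le> (real n * D) ^ n * ((real n * D) ^ n * real p ^ V) * ((real n * D) ^ n * real p ^ W)"
  proof -
    have "real n ^ n \<le> (real n * D) ^ n"
      using D by (intro power_mono) (auto simp: mult_le_cancel_left1)
    then show ?thesis
      using D nD by (intro mult_mono mult_left_mono mult_right_mono) auto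
  qed
  also have "\<dots> = (real n * D) ^ (3 * n) * real p ^ (V + W)"
    by (simp add: power_add numeral_3_eq_3 mult_ac)
  finally have le': "real p ^ (e * n) \<le> (real n * D) ^ (3 * n) * real p ^ (V + W)" .
  define x where "x = real n * D"
  have x: "x > 0" using nD by (simp add: x_def)
  have "log (real p) (real p ^ (e * n)) \<le> log (real p) (x ^ (3 * n) * real p ^ (V + W))"
    using le' p1 unfolding x_def by (intro log_mono) auto
  also have "\<dots> = log (real p) (x ^ (3 * n)) + log (real p) (real p ^ (V + W))"
    using p1 x by (simp add: log_mult)
  finally have "real (e * n) \<le> 3 * real n * log (real p) (real n * D) + (real V + real W)"
    using p1 x by (simp add: log_nat_power flip: x_def)
  then show False using big by simp
qed

text \<open>Stated for a single feasible pair, so that it serves both the supremum in MVMP and the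
  pair reached by Val-Det.\<close>

lemma mvmp_bound:
  fixes A :: "nat \<Rightarrow> int mat"
  assumes A: "\<And>k. k < m \<Longrightarrow> A k \<in> carrier_mat n n" and D: "D \<ge> 1"
    and bound: "\<And>k i j. k < m \<Longrightarrow> i < n \<Longrightarrow> j < n \<Longrightarrow> \<bar>real_of_int (A k $$ (i, j))\<bar> \<le> D"
    and feas: "(P, Q) \<in> mvmp_feasible p n m (\<lambda>k. map_mat rat_of_int (A k))"
    and big: "ereal (3 * real n * log (real p) (real n * D)) < - vp p (det P) - vp p (det Q)"
  shows "nc_rank n m (\<lambda>k. map_mat rat_of_int (A k)) < n"
proof -
  have PQ: "P \<in> carrier_mat n n" "det P \<noteq> 0" "Q \<in> carrier_mat n n" "det Q \<noteq> 0"
    using feas GL_det_nonzero by (auto simp: mvmp_feasible_def)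
  have int: "(P * map_mat of_int (A k) * Q) $$ (i, j) \<in> Zloc p" if "k < m" "i < n" "j < n" for k i j
    using feas that by (auto simp: mvmp_feasible_def vp_entry_def transform_def Zloc_def le_INF_iff)
  \<comment> \<open>For \<open>n = 0\<close> both determinants are 1 and \<open>big\<close> would
    read \<open>0 < 0\<close>.\<close>
  have n: "n > 0"
  proof (rule ccontr)
    assume "\<not> n > 0"
    then show False
      using big PQ vp_of_int[OF prime, of 1] by (simp add: zero_ereal_def[symmetric])
  qed
  obtain a where a: "\<And>i j. i < n \<Longrightarrow> j < n \<Longrightarrow> of_nat p ^ a * Q $$ (i, j) \<in> Zloc p"
    using Zloc_scale[of n Q] by blast
  obtain b where b: "\<And>i j. i < n \<Longrightarrow> j < n \<Longrightarrow> of_nat p ^ b * P\<^sup>T $$ (i, j) \<in> Zloc p"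
    using Zloc_scale[of n "P\<^sup>T"] by blast
  obtain B :: "nat \<Rightarrow> nat \<Rightarrow> int" and V :: nat where
    BL: "\<And>j. j < n \<Longrightarrow> \<exists>z. (\<forall>t<n. z t \<in> Zloc p) \<and>
        (\<forall>i<n. of_int (B j i) = of_nat p ^ a * (\<Sum>t<n. Q $$ (i, t) * z t))" and
    Bdet: "det (column_mat n B) \<noteq> 0" and
    Bsort: "\<And>i j. i \<le> j \<Longrightarrow> j < n \<Longrightarrow> intnorm n (B i) \<le> intnorm n (B j)" and
    Bprod: "(\<Prod>j<n. intnorm n (B j)) \<le> real n ^ n * real p ^ V" and
    V: "ereal (real V) \<le> vp p (det Q) + ereal (real (a * n))"
    using reduced_lattice_columns[OF PQ(3,4) a] by blast
  have PT: "P\<^sup>T \<in> carrier_mat n n" "det P\<^sup>T \<noteq> 0"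
    using PQ det_transpose[OF PQ(1)] by auto
  obtain C :: "nat \<Rightarrow> nat \<Rightarrow> int" and W :: nat where
    CL: "\<And>j. j < n \<Longrightarrow> \<exists>z. (\<forall>t<n. z t \<in> Zloc p) \<and>
        (\<forall>i<n. of_int (C j i) = of_nat p ^ b * (\<Sum>t<n. P\<^sup>T $$ (i, t) * z t))" and
    Cdet: "det (column_mat n C) \<noteq> 0" and
    Csort: "\<And>i j. i \<le> j \<Longrightarrow> j < n \<Longrightarrow> intnorm n (C i) \<le> intnorm n (C j)" and
    Cprod: "(\<Prod>j<n. intnorm n (C j)) \<le> real n ^ n * real p ^ W" and
    W: "ereal (real W) \<le> vp p (det P\<^sup>T) + ereal (real (b * n))"
    using reduced_lattice_columns[OF PT b] by blast
  obtain u where u: "vp p (det P) = ereal (real_of_int u)"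
    using vp_finite[OF prime PQ(2)] by blast
  obtain v where v: "vp p (det Q) = ereal (real_of_int v)"
    using vp_finite[OF prime PQ(4)] by blast
  \<comment> \<open>The exponents of scaling enter the index bounds as \<open>(a + b) * n\<close>,
    which is exactly the right-hand side of \<open>block_norm_exists\<close> with
    \<open>e = a + b\<close>; so the choice of \<open>a\<close> and \<open>b\<close> has no
    influence on the final bound.\<close>
  have "real V \<le> real_of_int v + real (a * n)" "real W \<le> real_of_int u + real (b * n)"
    using V W unfolding det_transpose[OF PQ(1)] u v by simp_all
  moreover have "3 * real n * log (real p) (real n * D) < - real_of_int u - real_of_int v"
    using big unfolding u v by simp
  ultimately have "3 * real n * log (real p) (real n * D) + real V + real W < real ((a + b) * n)"
    by (simp add: algebra_simps)
  then obtain i where i: "i < n"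
    and small: "real n * D * intnorm n (B i) * intnorm n (C (n - Suc i)) < real p ^ (a + b)"
    using block_norm_exists[of n D "\<lambda>j. intnorm n (B j)" "\<lambda>j. intnorm n (C j)", OF n D _ _ Bprod Cprod]
    by (force simp: intnorm_def)
  \<comment> \<open>By sortedness the pair \<open>(i, n - Suc i)\<close> is the worst case for all
    \<open>j \<le> i\<close> and \<open>l < n - i\<close>. An integer divisible by
    \<open>p ^ (a + b)\<close> and smaller in absolute value is zero.\<close>
  have zero: "int_bilinear n (A k) (C l) (B j) = 0" if k: "k < m" and l: "l < n - i" and j: "j < i + 1" for k l j
  proof -
    have lt: "l < n" "j < n" using i l j by auto
    obtain z where z: "\<forall>t<n. z t \<in> Zloc p"
        "\<forall>i<n. of_int (B j i) = of_nat p ^ a * (\<Sum>t<n. Q $$ (i, t) * z t)"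
      using BL[OF lt(2)] by blast
    obtain w where w: "\<forall>t<n. w t \<in> Zloc p"
        "\<forall>i<n. of_int (C l i) = of_nat p ^ b * (\<Sum>t<n. P\<^sup>T $$ (i, t) * w t)"
      using CL[OF lt(1)] by blast
    have dvd: "int p ^ (a + b) dvd int_bilinear n (A k) (C l) (B j)"
      by (rule int_bilinear_dvd[OF PQ(1) A[OF k] PQ(3) int[OF k] z w])
    have "\<bar>real_of_int (int_bilinear n (A k) (C l) (B j))\<bar> \<le> real n * D * intnorm n (B j) * intnorm n (C l)"
      using bound k D by (intro int_bilinear_bound) auto
    also have "\<dots> \<le> real n * D * intnorm n (B i) * intnorm n (C (n - Suc i))"
      using Bsort[of j i] Csort[of l "n - Suc i"] i l j D
      by (intro mult_mono mult_left_mono) (auto simp: intnorm_def)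
    also have "\<dots> < real p ^ (a + b)" by (rule small)
    finally have "\<bar>int_bilinear n (A k) (C l) (B j)\<bar> < int p ^ (a + b)"
      by (metis of_int_abs of_int_less_iff of_int_of_nat_eq of_int_power)
    then show ?thesis using dvd by (metis dvd_imp_le_int not_less power_abs abs_of_nat)
  qed
  define X where "X = map_mat rat_of_int (column_mat n B)"
  define Y where "Y = map_mat rat_of_int (column_mat n C)\<^sup>T"
  have XY: "X \<in> carrier_mat n n" "Y \<in> carrier_mat n n"
    by (simp_all add: X_def Y_def)
  have "det X \<noteq> 0" "det Y \<noteq> 0"
    using Bdet Cdet det_transpose[OF column_mat_carrier, of n C] by (simp_all add: X_def Y_def)
  then obtain X' Y' where X': "X' \<in> carrier_mat n n" "X * X' = 1\<^sub>m n"
    and Y': "Y' \<in> carrier_mat n n" "Y' * Y = 1\<^sub>m n"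
    using det_nonzero_inverse[OF XY(1)] det_nonzero_inverse[OF XY(2)] by metis
  show ?thesis
  \<comment> \<open>The block has \<open>(n - i) + (i + 1) = n + 1\<close> rows and columns
    together, just enough to force singularity.\<close>
  proof (rule nc_rank_less_if_zero_block[where X = X and Y = Y and X' = X' and Y' = Y' and r = "n - i" and s = "i + 1"])
    fix k l j assume k: "k < m" and l: "l < n - i" and j: "j < i + 1"
    then have lt: "l < n" "j < n" using i by auto
    have M: "map_mat rat_of_int (A k) \<in> carrier_mat n n" using A[OF k] by simp
    have YM: "Y * map_mat rat_of_int (A k) \<in> carrier_mat n n" using XY M by simp
    have "(Y * map_mat rat_of_int (A k) * X) $$ (l, j)
        = (\<Sum>t<n. (Y * map_mat rat_of_int (A k)) $$ (l, t) * X $$ (t, j))"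
      by (rule mat_mult_index_sum[OF YM XY(1) lt])
    also have "\<dots> = (\<Sum>t<n. Y $$ (l, t) * (\<Sum>s<n. map_mat rat_of_int (A k) $$ (t, s) * X $$ (s, j)))"
      by (rule sum_mat_mult_vec[OF XY(2) M lt(1), symmetric])
    also have "\<dots> = of_int (int_bilinear n (A k) (C l) (B j))"
      using lt A[OF k] by (simp add: int_bilinear_def X_def Y_def column_mat_def)
    also have "\<dots> = 0" using zero[OF k l j] by simp
    finally show "(Y * map_mat rat_of_int (A k) * X) $$ (l, j) = 0" .
  qed (use A XY X' Y' i in auto)
qed

end

section \<open>Progress of the algorithm\<close>

lemma GL_iff_det: "P \<in> GL n \<longleftrightarrow> P \<in> carrier_mat n n \<and> det P \<noteq> 0"
proof
  assume P: "P \<in> carrier_mat n n \<and> det P \<noteq> 0"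
  then obtain R where "R \<in> carrier_mat n n" "P * R = 1\<^sub>m n" "R * P = 1\<^sub>m n"
    using det_nonzero_inverse by blast
  then show "P \<in> GL n"
    using P by (auto simp: GL_def invertible_mat_def inverts_mat_def)
qed (use GL_det_nonzero in blast)

lemma det_mat_diag: "det (mat_diag n f :: 'a :: comm_ring_1 mat) = (\<Prod>i<n. f i)"
proof -
  have "det (mat_diag n f) = prod_list (diag_mat (mat_diag n f))"
    by (rule det_upper_triangular[of _ n]) (auto simp: mat_diag_def)
  then show ?thesis
    unfolding prod_list_diag_prod by (simp add: mat_diag_def atLeast0LessThan)
qed

text \<open>By the Leibniz formula the determinant is an integer polynomial in the entries, hence
  compatible with reduction. This connects invertibility over the residues with the integer
  determinant.\<close>

lemma det_mat_mod:
  assumes "N \<in> carrier_mat n n"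
  shows "det (mat_mod p N) mod int p = det N mod int p"
proof -
  have carr: "mat_mod p N \<in> carrier_mat n n" using assms by (simp add: mat_mod_def)
  have "(signof \<sigma> * (\<Prod>i = 0..<n. mat_mod p N $$ (i, \<sigma> i))) mod int p
      = (signof \<sigma> * (\<Prod>i = 0..<n. N $$ (i, \<sigma> i))) mod int p" if "\<sigma> permutes {0..<n}" for \<sigma>
  proof -
    have "(\<Prod>i = 0..<n. mat_mod p N $$ (i, \<sigma> i)) = (\<Prod>i = 0..<n. N $$ (i, \<sigma> i) mod int p)"
      using that assms permutes_in_image[OF that]
      by (intro prod.cong) (auto simp: mat_mod_def)
    then have "(\<Prod>i = 0..<n. mat_mod p N $$ (i, \<sigma> i)) mod int p = (\<Prod>i = 0..<n. N $$ (i, \<sigma> i)) mod int p"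
      by (simp add: mod_prod_eq)
    then show ?thesis by (rule mod_mult_cong[OF refl])
  qed
  then show ?thesis
    unfolding det_def'[OF assms] det_def'[OF carr]
    by (subst (1 2) mod_sum_eq[symmetric]) (auto intro!: arg_cong[of _ _ "\<lambda>a. a mod _"] sum.cong)
qed

context
  fixes p :: nat
  assumes prime: "prime p"
begin

lemma mvmp_feasible_iff:
  "(P, Q) \<in> mvmp_feasible p n m A \<longleftrightarrow> P \<in> GL n \<and> Q \<in> GL n \<and>
    (\<forall>k<m. \<forall>i<n. \<forall>j<n. (P * A k * Q) $$ (i, j) \<in> Zloc p)"
  by (auto simp: mvmp_feasible_def vp_entry_def transform_def Zloc_def le_INF_iff)

text \<open>Justifies the definite description in \<open>residue\<close>: existence is
  \<open>Zloc_residue\<close> with \<open>e = 1\<close>, and two candidates differ by a multiple of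
  \<open>p\<close> of absolute value below \<open>p\<close>.\<close>

lemma vp_diff_residue:
  assumes "x \<in> Zloc p"
  shows "1 \<le> vp p (x - of_int (residue p x))"
proof -
  obtain r where r: "0 \<le> r" "r < int p ^ 1" "ereal (real 1) \<le> vp p (x - of_int r)"
    using Zloc_residue[OF prime assms] by blast
  have r1: "1 \<le> vp p (x - of_int r)" using r(3) by (simp add: one_ereal_def)
  then have r0: "0 < vp p (x - of_int r)" by (rule less_le_trans[rotated]) simp
  have "residue p x = r"
    unfolding residue_def
  proof (rule the_equality)
    show "r \<in> {0..<int p} \<and> 0 < vp p (x - of_int r)"
      using r r0 by simp
    fix c assume c: "c \<in> {0..<int p} \<and> 0 < vp p (x - of_int c)"
    show "c = r"
    proof (rule ccontr)
      assume "c \<noteq> r"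
      obtain \<epsilon> where \<epsilon>: "0 < \<epsilon>" "\<epsilon> \<le> vp p (x - of_int c)" "\<epsilon> \<le> vp p (x - of_int r)"
        using c r0
        by (meson min.cobounded1 min.cobounded2 min_less_iff_conj)
      have "\<epsilon> \<le> vp p ((x - of_int r) + - (x - of_int c))"
        using \<epsilon> by (intro vp_add[OF prime]) (auto simp only: vp_minus[OF prime])
      also have "(x - of_int r) + - (x - of_int c) = of_int (c - r)" by simp
      finally have "0 < vp p (of_int (c - r))" using \<epsilon>(1) by (rule less_le_trans[rotated])
      then have "multiplicity (int p) (c - r) > 0"
        using vp_of_int[OF prime, of "c - r"] \<open>c \<noteq> r\<close> by (simp del: of_int_diff)
      then have "int p dvd c - r"
        using not_dvd_imp_multiplicity_0 by fastforce
      then show False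
        using dvd_imp_le_int[of "c - r" "int p"] \<open>c \<noteq> r\<close> c r by auto
    qed
  qed
  then show ?thesis using r1 by simp
qed

lemma vp_mult_Zloc:
  assumes "c \<le> vp p x" "y \<in> Zloc p"
  shows "c \<le> vp p (x * y)"
  using add_mono[of c "vp p x" 0 "vp p y"] assms by (simp add: vp_mult[OF prime] Zloc_def)

text \<open>From \<open>det S * det S'\<close> congruent to 1 modulo \<open>p\<close>, the integer
  lift of \<open>S\<close> has a determinant prime to \<open>p\<close>, so multiplication by it
  leaves the objective unchanged.\<close>

lemma GL_GF_vp_det:
  assumes "S \<in> GL_GF p n"
  shows "vp p (of_int (det S)) = 0"
proof -
  obtain S' where S: "S \<in> carrier_mat n n" "S' \<in> carrier_mat n n" "mat_mod p (S * S') = 1\<^sub>m n"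
    using assms by (auto simp: GL_GF_def mat_GF_def)
  have "(det S * det S') mod int p = 1 mod int p"
    using det_mat_mod[of "S * S'" n p] S det_mult[OF S(1,2)] by simp
  also have "\<dots> = 1" using prime_gt_1_nat[OF prime] by simp
  finally have "\<not> int p dvd det S"
    by (metis dvd_imp_mod_0 dvd_mult2 zero_neq_one)
  then show ?thesis
    using vp_of_int[OF prime, of "det S"] not_dvd_imp_multiplicity_0[of "int p" "det S"]
    by (cases "det S = 0") (auto simp: zero_ereal_def)
qed

text \<open>Replacing \<open>G\<close> by its residues changes \<open>S G T\<close> only by multiples of \<open>p\<close>.\<close>

lemma vp_zero_block_entry:
  assumes carr: "S \<in> carrier_mat n n" "G \<in> carrier_mat n n" "T \<in> carrier_mat n n"
    and G: "\<And>i j. i < n \<Longrightarrow> j < n \<Longrightarrow> G $$ (i, j) \<in> Zloc p"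
    and ij: "i < n" "j < n"
    and zero: "mat_mod p (S * map_mat (residue p) G * T) $$ (i, j) = 0"
  shows "1 \<le> vp p ((map_mat of_int S * G * map_mat of_int T) $$ (i, j))"
proof -
  let ?R = "map_mat (residue p) G"
  let ?S = "map_mat of_int S :: rat mat"
  let ?T = "map_mat of_int T :: rat mat"
  let ?e = "(S * ?R * T) $$ (i, j)"
  have R: "?R \<in> carrier_mat n n" and ST: "?S \<in> carrier_mat n n" "?T \<in> carrier_mat n n"
    using carr by auto
  have SR: "S * ?R \<in> carrier_mat n n" and SG: "?S * G \<in> carrier_mat n n" using carr by auto
  have entry: "(?S * G * ?T) $$ (i, j) = (\<Sum>t<n. (\<Sum>l<n. of_int (S $$ (i, l)) * G $$ (l, t)) * of_int (T $$ (t, j)))"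
    unfolding mat_mult_index_sum[OF SG ST(2) ij]
    using mat_mult_index_sum[OF ST(1) carr(2) ij(1)] carr ij by simp
  have entry': "of_int ?e = (\<Sum>t<n. (\<Sum>l<n. of_int (S $$ (i, l)) * of_int (residue p (G $$ (l, t)))) * of_int (T $$ (t, j)) :: rat)"
    unfolding mat_mult_index_sum[OF SR carr(3) ij]
    using mat_mult_index_sum[OF carr(1) R ij(1)] carr ij by simp
  have "(?S * G * ?T) $$ (i, j) - of_int ?e = (\<Sum>t<n. (\<Sum>l<n.
      (G $$ (l, t) - of_int (residue p (G $$ (l, t)))) * of_int (S $$ (i, l))) * of_int (T $$ (t, j)))"
    unfolding entry entry' by (simp add: sum_subtractf left_diff_distrib right_diff_distrib mult.commute)
  also have "1 \<le> vp p \<dots>"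
    using vp_diff_residue[OF G] Zloc_of_int[OF prime]
    by (intro vp_sum[OF prime] vp_mult_Zloc) auto
  finally have 1: "1 \<le> vp p ((?S * G * ?T) $$ (i, j) - of_int ?e)" .
  have "int p ^ 1 dvd ?e"
    using zero carr ij by (auto simp: mat_mod_def mod_eq_0_iff_dvd)
  then have "1 \<le> vp p (of_int ?e)"
    using vp_of_int_ge_iff[OF prime, of 1 ?e] by (simp add: one_ereal_def)
  then show ?thesis
    using vp_add[OF prime 1] by fastforce
qed

text \<open>\<open>S\<close> and \<open>T\<close> contribute nothing to the valuations of the
  determinants, while the diagonal matrices contribute \<open>- r\<close> and \<open>n - s\<close>;
  since \<open>n < r + s\<close>, the objective grows by at least 1. Integrality survives because
  the entries of the zero block are divisible by \<open>p\<close>.\<close>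

lemma val_det_step_progress:
  assumes A: "\<And>k. k < m \<Longrightarrow> A k \<in> carrier_mat n n"
    and feas: "(P, Q) \<in> mvmp_feasible p n m A"
    and step: "val_det_step p n m A (P, Q) (P', Q')"
  shows "(P', Q') \<in> mvmp_feasible p n m A"
    and "- vp p (det P) - vp p (det Q) + 1 \<le> - vp p (det P') - vp p (det Q')"
proof -
  obtain S T r s where opt: "fr_optimal p n m (reduce p (transform P A Q)) S T r s" and rs: "n < r + s"
    and P': "P' = mat_diag n (\<lambda>i. if i < r then 1 / of_nat p else 1) * map_mat of_int S * P"
    and Q': "Q' = Q * map_mat of_int T * mat_diag n (\<lambda>j. if j < s then 1 else of_nat p)"
    using step by (auto elim: val_det_step.cases)
  let ?f = "\<lambda>i. if i < r then 1 / of_nat p else 1 :: rat"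
  let ?g = "\<lambda>j. if j < s then 1 else of_nat p :: rat"
  let ?S = "map_mat of_int S :: rat mat"
  let ?T = "map_mat of_int T :: rat mat"
  have le: "r \<le> n" "s \<le> n" and STGL: "S \<in> GL_GF p n" "T \<in> GL_GF p n"
    and zb: "zero_block p m (reduce p (transform P A Q)) S T {..<r} {..<s}"
    using opt by (auto simp: fr_optimal_def)
  have ST: "S \<in> carrier_mat n n" "T \<in> carrier_mat n n"
    using STGL by (auto simp: GL_GF_def mat_GF_def)
  then have ST': "?S \<in> carrier_mat n n" "?T \<in> carrier_mat n n" by auto
  have PQ: "P \<in> carrier_mat n n" "det P \<noteq> 0" "Q \<in> carrier_mat n n" "det Q \<noteq> 0"
    and int: "\<And>k i j. k < m \<Longrightarrow> i < n \<Longrightarrow> j < n \<Longrightarrow> (P * A k * Q) $$ (i, j) \<in> Zloc p"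
    using feas by (auto simp: mvmp_feasible_iff GL_iff_det)
  have p0: "(of_nat p :: rat) \<noteq> 0" using prime prime_gt_0_nat by auto
  have "(\<Sum>i<n. vp p (?f i)) = (\<Sum>i<n. ereal (if i < r then - 1 else 0))"
    using vp_inverse_p[OF prime] vp_of_int[OF prime, of 1]
    by (intro sum.cong) (auto simp: one_ereal_def zero_ereal_def)
  also have "\<dots> = ereal (- real r)"
  proof -
    have "{..<n} \<inter> {i. i < r} = {..<r}" using le by auto
    then show ?thesis by (simp add: sum.If_cases)
  qed
  finally have vf: "vp p (\<Prod>i<n. ?f i) = ereal (- real r)"
    by (simp only: vp_prod[OF prime])
  have "(\<Sum>j<n. vp p (?g j)) = (\<Sum>j<n. ereal (if j < s then 0 else 1))"
    using vp_p[OF prime] vp_of_int[OF prime, of 1]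
    by (intro sum.cong) (auto simp: one_ereal_def zero_ereal_def)
  also have "\<dots> = ereal (real n - real s)"
  proof -
    have "{..<n} \<inter> - {j. j < s} = {s..<n}" by auto
    then show ?thesis using le by (simp add: sum.If_cases of_nat_diff)
  qed
  finally have vg: "vp p (\<Prod>j<n. ?g j) = ereal (real n - real s)"
    by (simp only: vp_prod[OF prime])
  have detP': "det P' = (\<Prod>i<n. ?f i) * of_int (det S) * det P"
    unfolding P' det_mult[OF mult_carrier_mat[OF mat_diag_dim ST'(1)] PQ(1)]
      det_mult[OF mat_diag_dim ST'(1)] det_mat_diag by simp
  have detQ': "det Q' = det Q * of_int (det T) * (\<Prod>j<n. ?g j)"
    unfolding Q' det_mult[OF mult_carrier_mat[OF PQ(3) ST'(2)] mat_diag_dim]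
      det_mult[OF PQ(3) ST'(2)] det_mat_diag by simp
  obtain u where u: "vp p (det P) = ereal (real_of_int u)" using vp_finite[OF prime PQ(2)] by blast
  obtain v where v: "vp p (det Q) = ereal (real_of_int v)" using vp_finite[OF prime PQ(4)] by blast
  have vP': "vp p (det P') = ereal (real_of_int u - real r)"
    unfolding detP' vp_mult[OF prime] GL_GF_vp_det[OF STGL(1)] u vf by simp
  have vQ': "vp p (det Q') = ereal (real_of_int v + real n - real s)"
    unfolding detQ' vp_mult[OF prime] GL_GF_vp_det[OF STGL(2)] v vg by simp
  have "real n + 1 \<le> real r + real s" using rs by linarith
  then show "- vp p (det P) - vp p (det Q) + 1 \<le> - vp p (det P') - vp p (det Q')"
    unfolding u v vP' vQ' by (simp add: one_ereal_def)
  have "P' \<in> carrier_mat n n" "Q' \<in> carrier_mat n n"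
    unfolding P' Q' using ST' PQ by (meson mult_carrier_mat mat_diag_dim)+
  then have "P' \<in> GL n" "Q' \<in> GL n"
    using vP' vQ' by (auto simp: GL_iff_det)
  moreover have "(P' * A k * Q') $$ (i, j) \<in> Zloc p" if k: "k < m" and ij: "i < n" "j < n" for k i j
  proof -
    let ?G = "P * A k * Q"
    let ?N = "?S * ?G * ?T"
    have G: "?G \<in> carrier_mat n n" using PQ A[OF k] by simp
    have N: "?N \<in> carrier_mat n n" using ST' G by simp
    have "P' * A k * Q' = mat_diag n ?f * (?N * mat_diag n ?g)"
      unfolding P' Q' using ST' PQ A[OF k]
      by (simp add: assoc_mult_mat[of _ n n _ n _ n])
    then have eq: "(P' * A k * Q') $$ (i, j) = ?f i * ?N $$ (i, j) * ?g j"
      using ij N by (simp add: mat_diag_mult_left[of _ n n] mat_diag_mult_right[of _ n n] mult.assoc)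
    have SG: "?S * ?G \<in> carrier_mat n n" using ST' G by simp
    have NZ: "?N $$ (i, j) \<in> Zloc p"
      unfolding mat_mult_index_sum[OF SG ST'(2) ij]
      using mat_mult_index_sum[OF ST'(1) G ij(1)] int[OF k] ST ij Zloc_of_int[OF prime]
      by (auto intro!: Zloc_sum[OF prime] Zloc_mult[OF prime])
    have pZ: "(of_nat p :: rat) \<in> Zloc p" using vp_p[OF prime] by (simp add: Zloc_def)
    \<comment> \<open>Rows from \<open>r\<close> on are not divided by \<open>p\<close>, and in the
      first \<open>r\<close> rows the columns from \<open>s\<close> on get the factors
      \<open>1 / p\<close> and \<open>p\<close>, which cancel. The remaining entries lie in the
      block that vanishes modulo \<open>p\<close>.\<close>
    show ?thesis
    proof (cases "i < r")
      case False
      then show ?thesis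
        unfolding eq using NZ pZ by (auto intro!: Zloc_mult[OF prime])
    next
      case i: True
      show ?thesis
      proof (cases "j < s")
        case False
        then show ?thesis unfolding eq using NZ i p0 by simp
      next
        case j: True
        have "mat_mod p (S * map_mat (residue p) ?G * T) $$ (i, j) = 0"
          using zb k i j by (auto simp: zero_block_def reduce_def transform_def)
        then have "1 \<le> vp p (?N $$ (i, j))"
          using int[OF k] by (intro vp_zero_block_entry[OF ST(1) G ST(2) _ ij]) auto
        then have "?N $$ (i, j) / of_nat p \<in> Zloc p"
          using p0 vp_p[OF prime] by (intro Zloc_divide[OF prime]) auto
        then show ?thesis unfolding eq using i j by simp
      qed
    qed
  qed
  ultimately show "(P', Q') \<in> mvmp_feasible p n m A"
    by (simp add: mvmp_feasible_iff)
qed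

text \<open>The initial pair is feasible because the entries of \<open>A\<close> are
  \<open>p\<close>-integral, and its objective is 0; every update adds at least 1, so the objective
  bounds the number of updates.\<close>

lemma val_det_run_progress:
  assumes A: "\<And>k. k < m \<Longrightarrow> A k \<in> carrier_mat n n"
    and int: "\<And>k i j. k < m \<Longrightarrow> i < n \<Longrightarrow> j < n \<Longrightarrow> A k $$ (i, j) \<in> Zloc p"
    and run: "(val_det_step p n m A ^^ N) (1\<^sub>m n, 1\<^sub>m n) (P, Q)"
  shows "(P, Q) \<in> mvmp_feasible p n m A \<and> ereal (real N) \<le> - vp p (det P) - vp p (det Q)"
  using run
proof (induction N arbitrary: P Q)
  case 0
  have "vp p 1 = 0" using vp_of_int[OF prime, of 1] by (simp add: zero_ereal_def)
  moreover have "1\<^sub>m n * A k * 1\<^sub>m n = A k" if "k < m" for k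
    using A[OF that] by simp
  ultimately show ?case
    using 0 int by (auto simp: mvmp_feasible_iff GL_iff_det zero_ereal_def)
next
  case (Suc N)
  then obtain P0 Q0 where run: "(val_det_step p n m A ^^ N) (1\<^sub>m n, 1\<^sub>m n) (P0, Q0)"
    and step: "val_det_step p n m A (P0, Q0) (P, Q)"
    by auto
  have "(P0, Q0) \<in> mvmp_feasible p n m A" and N: "ereal (real N) \<le> - vp p (det P0) - vp p (det Q0)"
    using Suc.IH[OF run] by auto
  note progress = val_det_step_progress[OF A this(1) step]
  have "ereal (real (Suc N)) = ereal (real N) + 1" by (simp add: one_ereal_def)
  also have "\<dots> \<le> - vp p (det P0) - vp p (det Q0) + 1" using N by (rule add_right_mono)
  also have "\<dots> \<le> - vp p (det P) - vp p (det Q)" by (rule progress(2))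
  finally show ?case using progress(1) by blast
qed

end

section \<open>The optimal value of MVMP and the number of iterations\<close>

theorem proposition4p5:
  shows "\<exists>C::real. C > 0 \<and>
    (\<forall>(p::nat) (n::nat) (m::nat) (A :: nat \<Rightarrow> int mat) (D::real).
       prime p \<longrightarrow> D \<ge> 1 \<longrightarrow>
       (\<forall>k<m. A k \<in> carrier_mat n n) \<longrightarrow>
       (\<forall>k<m. \<forall>i<n. \<forall>j<n. \<bar>real_of_int (A k $$ (i, j))\<bar> \<le> D) \<longrightarrow>
       (let A\<^sub>Q = (\<lambda>k. map_mat rat_of_int (A k)) in
         (nc_regular n m A\<^sub>Q \<longrightarrow>
            vp_Det' p n m A\<^sub>Q \<le> ereal (C * real n * log (real p) (real n * D))) \<and>
         (\<forall>N. val_det_performs p n m A\<^sub>Q N \<longrightarrow>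
            real N > C * real n * log (real p) (real n * D) \<longrightarrow>
            nc_singular n m A\<^sub>Q)))"
proof (intro exI[of _ 3] conjI allI impI)
  fix p n m :: nat and A :: "nat \<Rightarrow> int mat" and D :: real
  assume prime: "prime p" and D: "D \<ge> 1" and A: "\<forall>k<m. A k \<in> carrier_mat n n"
    and bound: "\<forall>k<m. \<forall>i<n. \<forall>j<n. \<bar>real_of_int (A k $$ (i, j))\<bar> \<le> D"
  let ?A = "\<lambda>k. map_mat rat_of_int (A k)"
  let ?b = "3 * real n * log (real p) (real n * D)"
  \<comment> \<open>A feasible pair with objective above the bound certifies singularity. For a
    regular pencil there is none, which bounds the supremum; after \<open>N > ?b\<close> updates the
    current pair of Val-Det is one.\<close>
  have main: "nc_rank n m ?A < n"
    if "(P, Q) \<in> mvmp_feasible p n m ?A" "ereal ?b < - vp p (det P) - vp p (det Q)" for P Q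
    using mvmp_bound[OF prime _ D _ that] A bound by blast
  have "vp_Det' p n m ?A \<le> ereal ?b" if "nc_regular n m ?A"
    unfolding vp_Det'_def
  proof (rule SUP_least)
    fix PQ assume "PQ \<in> mvmp_feasible p n m ?A"
    then show "(case PQ of (P, Q) \<Rightarrow> - vp p (det P) - vp p (det Q)) \<le> ereal ?b"
      using main[of "fst PQ" "snd PQ"] that by (cases PQ) (force simp: nc_regular_def not_less)
  qed
  moreover have "nc_singular n m ?A" if performs: "val_det_performs p n m ?A N" and N: "real N > ?b" for N
  proof -
    obtain P Q where "(val_det_step p n m ?A ^^ N) (1\<^sub>m n, 1\<^sub>m n) (P, Q)"
      using performs by (auto simp: val_det_performs_def)
    moreover have "?A k $$ (i, j) \<in> Zloc p" if "k < m" "i < n" "j < n" for k i j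
    proof -
      have "A k \<in> carrier_mat n n" using A that by blast
      then show ?thesis using that Zloc_of_int[OF prime] by auto
    qed
    ultimately have "(P, Q) \<in> mvmp_feasible p n m ?A" "ereal (real N) \<le> - vp p (det P) - vp p (det Q)"
      using val_det_run_progress[OF prime, of m ?A n N P Q] A by auto
    then show ?thesis
      using main[of P Q] N less_le_trans[of "ereal ?b" "ereal (real N)"] by (simp add: nc_singular_def)
  qed
  ultimately show "let A\<^sub>Q = ?A in
      (nc_regular n m A\<^sub>Q \<longrightarrow> vp_Det' p n m A\<^sub>Q \<le> ereal ?b) \<and>
      (\<forall>N. val_det_performs p n m A\<^sub>Q N \<longrightarrow> real N > ?b \<longrightarrow> nc_singular n m A\<^sub>Q)"
    by (simp add: Let_def)
qed simp

end
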